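(* Let $X$ and $Y$ be Banach spaces, and let $\mathcal{I}$ be an operator ideal. If the set $\operatorname{smo}(X^* )\cap\operatorname{NA}(X)$ is dense in $X^*$, $Y$ has property quasi-$\beta$, and $\mathcal{I}(X,Y)\subseteq\mathcal{DP}(X,Y)$, then $$\mathcal{I}(X,Y)\subseteq\overline{\mathcal{I}(X,Y)\cap\operatorname{RSE}(X,Y)}.$$
   Context: Banach spaces are over $\mathbb{K}$, where $\mathbb{K}=\mathbb{R}$ or $\mathbb{C}$, and are nonzero. $\mathbb{T}=\{\theta\in\mathbb{K}\colon|\theta|=1\}$; $B_X$, $S_X$ are the closed unit ball and unit sphere; $\mathcal{L}(X,Y)$ is the space of bounded linear operators with the operator norm, and closures of sets of operators are in this norm. $\operatorname{NA}(X)$ is the set of $x^*\in X^*$ with $|x^*(x)|=\|x^*\|$ for some $x\in B_X$. $\operatorname{smo}(X^* )$ is the set of points of $X^*$ at which the norm of $X^*$ is G\^ateaux differentiable. $\mathcal{DP}(X,Y)$ is the set of Dunford--Pettis operators (operators mapping weakly convergent sequences to norm convergent sequences). Operator ideals are understood in the usual (Pietsch) sense; in particular they contain all finite-rank operators. $T\in\operatorname{RSE}(X,Y)$ (range strongly exposing) means: there exists $x_0\in S_X$ such that whenever $(x_n)\subseteq B_X$ satisfies $\|Tx_n\|\to\|T\|$, there are a subsequence $(x_{\sigma(n)})$ and $\theta\in\mathbb{T}$ with $Tx_{\sigma(n)}\to\theta Tx_0$ in norm. $Y$ has property quasi-$\beta$ (Acosta--Aguirre--Pay\'a) if there exist a set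 $A=\{y_\alpha^*\colon\alpha\in\Lambda\}\subseteq S_{Y^*}$, a set $\{y_\alpha\colon\alpha\in\Lambda\}\subseteq S_Y$ and a function $\rho\colon A\to\mathbb{R}$ such that: (i) $y_\alpha^*(y_\alpha)=1$ for all $\alpha\in\Lambda$; (ii) $|z^*(y_\alpha)|\le\rho(y_\alpha^* )<1$ for all $\alpha\in\Lambda$ and all $z^*\in A$ with $z^*\ne y_\alpha^*$; (iii) for every extreme point $e^*$ of $B_{Y^*}$ there are a subset $A_{e^*}\subseteq A$ and $t\in\mathbb{T}$ such that $te^*$ belongs to the weak-star closure of $A_{e^*}$ and $\sup\{\rho(y^* )\colon y^*\in A_{e^*}\}<1$. *)

theory Defs
  imports "HOL-Analysis.Analysis" "HOL-Algebra.Module"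
begin

section \<open>Banach spaces over the reals or the complex numbers\<close>

text \<open>
  The scalar field is a set \<open>K\<close> of complex numbers, either \<open>\<real>\<close> or \<open>UNIV\<close>, so that the real and
  the complex case are treated at once. Spaces are given by explicit carriers, because an operator
  ideal has to range over all Banach spaces and this cannot be expressed with type classes.
  The fields \<open>mult\<close> and \<open>one\<close>, which the record of modules inherits from rings, play no role.
\<close>

definition scalar_ring :: "complex set \<Rightarrow> complex ring" where
  "scalar_ring K = \<lparr>carrier = K, mult = (*), one = 1, zero = 0, add = (+)\<rparr>"

record 'a nmodule = "(complex, 'a) module" +
  nrm :: "'a \<Rightarrow> real"

locale normed_space = Module.module "scalar_ring K" X
  for K :: "complex set" and X :: "'a nmodule" (structure) +
  assumes scalars: "K = \<real> \<or> K = UNIV"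
    and nrm_nonneg: "x \<in> carrier X \<Longrightarrow> 0 \<le> nrm X x"
    and nrm_eq_0_iff: "x \<in> carrier X \<Longrightarrow> nrm X x = 0 \<longleftrightarrow> x = \<zero>"
    and nrm_smult: "c \<in> K \<Longrightarrow> x \<in> carrier X \<Longrightarrow> nrm X (c \<odot> x) = cmod c * nrm X x"
    and nrm_triangle:
      "x \<in> carrier X \<Longrightarrow> y \<in> carrier X \<Longrightarrow> nrm X (x \<oplus> y) \<le> nrm X x + nrm X y"

text \<open>The value outside the carrier is fixed because the locale \<open>Metric_space\<close> requires
  nonnegativity and symmetry on the whole type.\<close>

definition norm_dist :: "'a nmodule \<Rightarrow> 'a \<Rightarrow> 'a \<Rightarrow> real" where
  "norm_dist X x y =
    (if x \<in> carrier X \<and> y \<in> carrier X then nrm X (x \<ominus>\<^bsub>X\<^esub> y) else 0)"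

definition norm_topology :: "'a nmodule \<Rightarrow> 'a topology" where
  "norm_topology X = Metric_space.mtopology (carrier X) (norm_dist X)"

locale banach_space = normed_space +
  assumes complete: "Metric_space.mcomplete (carrier X) (norm_dist X)"
    and nonzero: "carrier X \<noteq> {\<zero>}"

definition unit_ball :: "'a nmodule \<Rightarrow> 'a set" where
  "unit_ball X = {x \<in> carrier X. nrm X x \<le> 1}"

definition unit_sphere :: "'a nmodule \<Rightarrow> 'a set" where
  "unit_sphere X = {x \<in> carrier X. nrm X x = 1}"

definition unit_scalars :: "complex set \<Rightarrow> complex set" where
  "unit_scalars K = {\<theta> \<in> K. cmod \<theta> = 1}"

section \<open>Bounded operators and duals\<close>

text \<open>Operators are extensional functions (\<open>undefined\<close> outside the carrier of the domain), so that
  equality of operators is equality in HOL.\<close>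

definition bounded_operators ::
  "complex set \<Rightarrow> 'a nmodule \<Rightarrow> 'b nmodule \<Rightarrow> ('a \<Rightarrow> 'b) set" where
  "bounded_operators K X Y = {T \<in> carrier X \<rightarrow>\<^sub>E carrier Y.
    (\<forall>x\<in>carrier X. \<forall>y\<in>carrier X. T (x \<oplus>\<^bsub>X\<^esub> y) = T x \<oplus>\<^bsub>Y\<^esub> T y) \<and>
    (\<forall>c\<in>K. \<forall>x\<in>carrier X. T (c \<odot>\<^bsub>X\<^esub> x) = c \<odot>\<^bsub>Y\<^esub> T x) \<and>
    (\<exists>C. \<forall>x\<in>carrier X. nrm Y (T x) \<le> C * nrm X x)}"

definition operator_norm :: "'a nmodule \<Rightarrow> 'b nmodule \<Rightarrow> ('a \<Rightarrow> 'b) \<Rightarrow> real" where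
  "operator_norm X Y T = (SUP x\<in>unit_ball X. nrm Y (T x))"

definition operator_space ::
  "complex set \<Rightarrow> 'a nmodule \<Rightarrow> 'b nmodule \<Rightarrow> ('a \<Rightarrow> 'b) nmodule" where
  "operator_space K X Y =
    \<lparr>carrier = bounded_operators K X Y, mult = undefined, one = undefined,
     zero = (\<lambda>x\<in>carrier X. \<zero>\<^bsub>Y\<^esub>),
     add = (\<lambda>S T. \<lambda>x\<in>carrier X. S x \<oplus>\<^bsub>Y\<^esub> T x),
     smult = (\<lambda>c T. \<lambda>x\<in>carrier X. c \<odot>\<^bsub>Y\<^esub> T x),
     nrm = operator_norm X Y\<rparr>"

definition scalar_space :: "complex set \<Rightarrow> complex nmodule" where
  "scalar_space K =
    \<lparr>carrier = K, mult = (*), one = 1, zero = 0, add = (+), smult = (*), nrm = cmod\<rparr>"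

definition dual :: "complex set \<Rightarrow> 'a nmodule \<Rightarrow> ('a \<Rightarrow> complex) nmodule" where
  "dual K X = operator_space K X (scalar_space K)"

definition weakly_converges ::
  "complex set \<Rightarrow> 'a nmodule \<Rightarrow> (nat \<Rightarrow> 'a) \<Rightarrow> 'a \<Rightarrow> bool" where
  "weakly_converges K X x l \<longleftrightarrow> range x \<subseteq> carrier X \<and> l \<in> carrier X \<and>
    (\<forall>f\<in>carrier (dual K X). (\<lambda>n. f (x n)) \<longlonglongrightarrow> f l)"

definition weak_star_topology ::
  "complex set \<Rightarrow> 'a nmodule \<Rightarrow> ('a \<Rightarrow> complex) topology" where
  "weak_star_topology K X =
    subtopology (product_topology (\<lambda>_. euclidean) (carrier X)) (carrier (dual K X))"

section \<open>Classes of operators and functionals\<close>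

definition finite_rank_operators ::
  "complex set \<Rightarrow> 'a nmodule \<Rightarrow> 'b nmodule \<Rightarrow> ('a \<Rightarrow> 'b) set" where
  "finite_rank_operators K X Y = {T \<in> bounded_operators K X Y.
    \<exists>B. finite B \<and> B \<subseteq> carrier Y \<and>
      (\<forall>x\<in>carrier X. \<exists>c\<in>B \<rightarrow> K. T x = (\<Oplus>\<^bsub>Y\<^esub>b\<in>B. c b \<odot>\<^bsub>Y\<^esub> b))}"

text \<open>
  An ideal assigns to every pair of Banach spaces a set of operators. The type \<open>'u\<close> serves as
  a universe: all Banach spaces whose carrier is a subset of \<open>'u\<close> are taken into account.
\<close>

definition operator_ideal ::
  "complex set \<Rightarrow> ('u nmodule \<Rightarrow> 'u nmodule \<Rightarrow> ('u \<Rightarrow> 'u) set) \<Rightarrow> bool" where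
  "operator_ideal K I \<longleftrightarrow>
    (\<forall>E F. banach_space K E \<longrightarrow> banach_space K F \<longrightarrow>
      I E F \<subseteq> bounded_operators K E F \<and>
      finite_rank_operators K E F \<subseteq> I E F \<and>
      (\<forall>S\<in>I E F. \<forall>T\<in>I E F. S \<oplus>\<^bsub>operator_space K E F\<^esub> T \<in> I E F)) \<and>
    (\<forall>E\<^sub>0 E F F\<^sub>0. banach_space K E\<^sub>0 \<longrightarrow> banach_space K E \<longrightarrow>
      banach_space K F \<longrightarrow> banach_space K F\<^sub>0 \<longrightarrow>
      (\<forall>R\<in>bounded_operators K E\<^sub>0 E. \<forall>T\<in>I E F. \<forall>S\<in>bounded_operators K F F\<^sub>0.
        compose (carrier E\<^sub>0) S (compose (carrier E\<^sub>0) T R) \<in> I E\<^sub>0 F\<^sub>0))"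

definition dunford_pettis_operators ::
  "complex set \<Rightarrow> 'a nmodule \<Rightarrow> 'b nmodule \<Rightarrow> ('a \<Rightarrow> 'b) set" where
  "dunford_pettis_operators K X Y = {T \<in> bounded_operators K X Y.
    \<forall>x. (\<exists>l. weakly_converges K X x l) \<longrightarrow>
      (\<exists>y. limitin (norm_topology Y) (\<lambda>n. T (x n)) y sequentially)}"

definition RSE :: "complex set \<Rightarrow> 'a nmodule \<Rightarrow> 'b nmodule \<Rightarrow> ('a \<Rightarrow> 'b) set" where
  "RSE K X Y = {T \<in> bounded_operators K X Y.
    \<exists>x\<^sub>0\<in>unit_sphere X. \<forall>x :: nat \<Rightarrow> 'a.
      range x \<subseteq> unit_ball X \<and> (\<lambda>n. nrm Y (T (x n))) \<longlonglongrightarrow> operator_norm X Y T \<longrightarrow>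
      (\<exists>\<sigma> :: nat \<Rightarrow> nat. strict_mono \<sigma> \<and> (\<exists>\<theta>\<in>unit_scalars K.
        limitin (norm_topology Y) (\<lambda>n. T (x (\<sigma> n))) (\<theta> \<odot>\<^bsub>Y\<^esub> T x\<^sub>0) sequentially))}"

definition NA :: "complex set \<Rightarrow> 'a nmodule \<Rightarrow> ('a \<Rightarrow> complex) set" where
  "NA K X = {f \<in> carrier (dual K X). \<exists>x\<in>unit_ball X. cmod (f x) = nrm (dual K X) f}"

text \<open>
  The derivative of a norm is taken with respect to real scalars, also when \<open>K = UNIV\<close>;
  \<open>dual \<real> X\<close> is the dual of the underlying real space, whose elements have real values.
\<close>

definition smooth_points :: "'a nmodule \<Rightarrow> 'a set" where
  "smooth_points X = {x \<in> carrier X. \<exists>D\<in>carrier (dual \<real> X). \<forall>h\<in>carrier X.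
    ((\<lambda>t::real. of_real ((nrm X (x \<oplus>\<^bsub>X\<^esub> of_real t \<odot>\<^bsub>X\<^esub> h) - nrm X x) / t)) \<longlongrightarrow> D h) (at 0)}"

section \<open>Property quasi-beta\<close>

definition extreme_points :: "'a nmodule \<Rightarrow> 'a set \<Rightarrow> 'a set" where
  "extreme_points X C = {e \<in> C. \<forall>a\<in>C. \<forall>b\<in>C. \<forall>t::real. 0 < t \<and> t < 1 \<and>
    e = of_real (1 - t) \<odot>\<^bsub>X\<^esub> a \<oplus>\<^bsub>X\<^esub> of_real t \<odot>\<^bsub>X\<^esub> b \<longrightarrow> a = b}"

text \<open>
  An existential quantifier cannot range over types, so the index set \<open>\<Lambda>\<close> is taken in a fixed type.
  This is no restriction: an arbitrary family may be re-indexed by the set of its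
  pairs \<open>(ystar \<alpha>, y \<alpha>)\<close>.
\<close>

definition property_quasi_beta :: "complex set \<Rightarrow> 'a nmodule \<Rightarrow> bool" where
  "property_quasi_beta K Y \<longleftrightarrow>
    (\<exists>(\<Lambda> :: (('a \<Rightarrow> complex) \<times> 'a) set) ystar y A (\<rho> :: ('a \<Rightarrow> complex) \<Rightarrow> real).
      A = ystar ` \<Lambda> \<and> A \<subseteq> unit_sphere (dual K Y) \<and> y ` \<Lambda> \<subseteq> unit_sphere Y \<and>
      (\<forall>\<alpha>\<in>\<Lambda>. ystar \<alpha> (y \<alpha>) = 1) \<and>
      (\<forall>\<alpha>\<in>\<Lambda>. \<forall>z\<in>A. z \<noteq> ystar \<alpha> \<longrightarrow>
        cmod (z (y \<alpha>)) \<le> \<rho> (ystar \<alpha>) \<and> \<rho> (ystar \<alpha>) < 1) \<and>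
      (\<forall>e\<in>extreme_points (dual K Y) (unit_ball (dual K Y)).
        \<exists>A\<^sub>e t. A\<^sub>e \<subseteq> A \<and> t \<in> unit_scalars K \<and>
          t \<odot>\<^bsub>dual K Y\<^esub> e \<in> weak_star_topology K Y closure_of A\<^sub>e \<and>
          (SUP a\<in>A\<^sub>e. \<rho> a) < 1))"

end

theory Submission
  imports Defs
begin

text \<open>
  Write \<open>f \<otimes> v\<close> for the rank one operator \<open>x \<mapsto> f x \<odot> v\<close>. Let \<open>a = y\<^sub>\<alpha>\<^sup>*\<close>, \<open>u = y\<^sub>\<alpha>\<close> be a pair from property
  quasi-beta, and suppose that \<open>|b u| \<le> r < 1\<close> for every other functional \<open>b\<close> of the family. Passing
  from \<open>S\<close> to \<open>R = S + \<psi> \<otimes> u\<close> changes \<open>a \<circ> S\<close> by \<open>\<psi>\<close>, but every other \<open>b \<circ> S\<close> by at most \<open>r \<parallel>\<psi>\<parallel>\<close>. Hence, if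
  \<open>\<parallel>a \<circ> S\<parallel>\<close> is close to \<open>\<parallel>S\<parallel>\<close>, a small \<open>\<psi>\<close> turns \<open>a \<circ> S\<close> into \<open>(1 + \<eta>) \<phi>\<close>, where \<open>\<phi>\<close> is a smooth norm attaining
  functional near \<open>a \<circ> S\<close>, and makes \<open>a\<close> beat all the other functionals of the family by a fixed margin.
  As the family is norming, \<open>\<parallel>R x\<^sub>n\<parallel> \<rightarrow> \<parallel>R\<parallel>\<close> then forces \<open>|\<phi> x\<^sub>n| \<rightarrow> \<parallel>\<phi>\<parallel>\<close>. Smoothness of \<open>\<phi>\<close> gives, up to
  rotations of the \<open>x\<^sub>n\<close>, weak convergence to a point where \<open>\<phi>\<close> attains its norm (\<open>Smulyan\<close>), and the
  Dunford--Pettis property makes the images converge in norm. This is \<open>RSE_criterion\<close> together with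
  \<open>RSE_perturbation\<close>.

  How close \<open>\<parallel>a \<circ> S\<parallel>\<close> has to be to \<open>\<parallel>S\<parallel>\<close> depends on \<open>r\<close>, and quasi-beta bounds \<open>r\<close> away from 1 only for the
  functionals of the family that serve one extreme point \<open>e\<close> of the dual ball. So \<open>e\<close> has to be found first:
  \<open>adjoint_nearly_norming_extreme_point\<close> provides, near \<open>T\<close>, an \<open>e\<close> and for every \<open>\<kappa>\<close> an operator \<open>S\<close> with
  \<open>\<parallel>S\<parallel> - \<kappa> < |e (S x)|\<close> for some \<open>x\<close> in the unit ball. Following Lindenstrauss and Zizler, put
  \<open>T\<^sub>k\<^sub>+\<^sub>1 = T\<^sub>k + w\<^sub>k (h\<^sub>k \<otimes> v\<^sub>k)\<close>, where \<open>v\<^sub>k\<close> is the direction of \<open>T\<^sub>k x\<^sub>k\<close>, the vector \<open>x\<^sub>k\<close> nearly norms \<open>T\<^sub>k\<close>, and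
  \<open>h\<^sub>k x\<^sub>k = 1 = \<parallel>h\<^sub>k\<parallel>\<close>. If the weights \<open>w\<^sub>k\<close> decrease fast, a functional that nearly norms some later \<open>T\<^sub>j\<close> nearly
  norms \<open>v\<^sub>k\<close>. By compactness one functional \<open>z\<close> nearly norms all \<open>v\<^sub>k\<close>, with summable errors. An ideal need
  not be closed, so the limit of the \<open>T\<^sub>k\<close> is avoided; all operators used are finite rank perturbations of \<open>T\<close>.

  An extreme point is reached from \<open>z\<close> by minimizing an affine function
  (\<open>extreme_point_asymptotically_norming\<close>). For suitable scalars \<open>c\<^sub>k\<close> of modulus at most 1, the function
  \<open>f \<mapsto> \<Sum>k. 1 - Re (c\<^sub>k f v\<^sub>k)\<close> on the dual ball is affine, lower semicontinuous, nonnegative and finite at \<open>z\<close>. The set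
  where it is minimal is therefore a nonempty closed face and contains an extreme point \<open>e\<close>; the series
  converges at \<open>e\<close>, whence \<open>|e v\<^sub>k| \<rightarrow> 1\<close>.

  The functional analysis underneath, namely the theorems of Hahn--Banach, Banach--Alaoglu and Krein--Milman, is
  developed for spaces with explicit carriers. Norms of vectors and of operators are estimated by pairing with
  the dual ball, which turns computations in \<open>Y\<close> into computations with complex numbers.
\<close>

section \<open>Normed spaces with explicit carriers\<close>

lemma scalar_ring_simps [simp]:
  "carrier (scalar_ring K) = K"
  "add (scalar_ring K) = (+)" "mult (scalar_ring K) = (*)"
  "\<zero>\<^bsub>scalar_ring K\<^esub> = 0" "\<one>\<^bsub>scalar_ring K\<^esub> = 1"
  by (simp_all add: scalar_ring_def)

lemma operator_space_simps [simp]: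
  "carrier (operator_space K X Y) = bounded_operators K X Y"
  "\<zero>\<^bsub>operator_space K X Y\<^esub> = (\<lambda>x\<in>carrier X. \<zero>\<^bsub>Y\<^esub>)"
  "S \<oplus>\<^bsub>operator_space K X Y\<^esub> T = (\<lambda>x\<in>carrier X. S x \<oplus>\<^bsub>Y\<^esub> T x)"
  "c \<odot>\<^bsub>operator_space K X Y\<^esub> T = (\<lambda>x\<in>carrier X. c \<odot>\<^bsub>Y\<^esub> T x)"
  "nrm (operator_space K X Y) = operator_norm X Y"
  by (simp_all add: operator_space_def)

lemma scalar_space_simps [simp]:
  "carrier (scalar_space K) = K"
  "\<zero>\<^bsub>scalar_space K\<^esub> = 0"
  "a \<oplus>\<^bsub>scalar_space K\<^esub> b = a + b"
  "c \<odot>\<^bsub>scalar_space K\<^esub> b = c * b"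
  "nrm (scalar_space K) = cmod"
  by (simp_all add: scalar_space_def)

lemma scalar_ring_cring:
  assumes "K = \<real> \<or> K = UNIV"
  shows "cring (scalar_ring K)"
proof (rule cringI)
  show "abelian_group (scalar_ring K)"
  proof (rule abelian_groupI)
    fix x assume "x \<in> carrier (scalar_ring K)"
    then show "\<exists>y\<in>carrier (scalar_ring K). y \<oplus>\<^bsub>scalar_ring K\<^esub> x = \<zero>\<^bsub>scalar_ring K\<^esub>"
      using assms by (intro bexI[of _ "- x"]) auto
  qed (use assms in \<open>auto simp: algebra_simps\<close>)
  show "comm_monoid (scalar_ring K)"
    by (rule comm_monoidI) (use assms in \<open>auto simp: algebra_simps\<close>)
qed (use assms in \<open>auto simp: algebra_simps\<close>)

context normed_space
begin

lemma scalar_closed [simp, intro]: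
  "0 \<in> K" "1 \<in> K" "of_real r \<in> K" "a \<in> K \<Longrightarrow> - a \<in> K" "a \<in> K \<Longrightarrow> cnj a \<in> K"
  "a \<in> K \<Longrightarrow> b \<in> K \<Longrightarrow> a + b \<in> K" "a \<in> K \<Longrightarrow> b \<in> K \<Longrightarrow> a - b \<in> K"
  "a \<in> K \<Longrightarrow> b \<in> K \<Longrightarrow> a * b \<in> K"
  using scalars by (auto elim!: Reals_cases)

lemma sgn_scalar [simp]: "a \<in> K \<Longrightarrow> sgn a \<in> K"
  using scalars by (auto elim!: Reals_cases simp: sgn_of_real)

lemma inverse_scalar [simp]: "a \<in> K \<Longrightarrow> inverse a \<in> K"
  using scalars by (auto elim!: Reals_cases simp flip: of_real_inverse)

lemma closed_scalars: "closed K"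
  using scalars closed_complex_Reals by auto

lemma smult_add_left:
  "a \<in> K \<Longrightarrow> b \<in> K \<Longrightarrow> x \<in> carrier X \<Longrightarrow> (a + b) \<odot> x = a \<odot> x \<oplus> b \<odot> x"
  using smult_l_distr[of a b x] by simp

lemma smult_add_right:
  "a \<in> K \<Longrightarrow> x \<in> carrier X \<Longrightarrow> y \<in> carrier X \<Longrightarrow> a \<odot> (x \<oplus> y) = a \<odot> x \<oplus> a \<odot> y"
  using smult_r_distr[of a x y] by simp

lemma smult_smult:
  "a \<in> K \<Longrightarrow> b \<in> K \<Longrightarrow> x \<in> carrier X \<Longrightarrow> a \<odot> (b \<odot> x) = (a * b) \<odot> x"
  using smult_assoc1[of a b x] by simp

lemma one_smult [simp]: "x \<in> carrier X \<Longrightarrow> 1 \<odot> x = x"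
  using smult_one[of x] by simp

lemma smult_zero_left [simp]: "x \<in> carrier X \<Longrightarrow> 0 \<odot> x = \<zero>"
  using smult_l_null[of x] by simp

lemma minus_eq_smult: "x \<in> carrier X \<Longrightarrow> \<ominus> x = (-1) \<odot> x"
proof -
  assume x: "x \<in> carrier X"
  have "(-1) \<odot> x \<oplus> x = (-1 + 1) \<odot> x"
    using smult_add_left[of "-1" 1 x] x by simp
  then show ?thesis
    using x by (intro M.minus_equality) auto
qed

lemma nrm_zero [simp]: "nrm X \<zero> = 0"
  using nrm_eq_0_iff[of \<zero>] by simp

lemma nrm_minus [simp]: "x \<in> carrier X \<Longrightarrow> nrm X (\<ominus> x) = nrm X x"
  using nrm_smult[of "-1" x] by (simp add: minus_eq_smult)

lemma diff_eq_smult: "x \<in> carrier X \<Longrightarrow> y \<in> carrier X \<Longrightarrow> x \<ominus> y = x \<oplus> (-1) \<odot> y"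
  by (simp add: a_minus_def minus_eq_smult)

lemma diff_eq_0_iff:
  "x \<in> carrier X \<Longrightarrow> y \<in> carrier X \<Longrightarrow> x \<ominus> y = \<zero> \<longleftrightarrow> x = y"
  by (metis M.minus_equality M.minus_minus M.a_inv_closed M.r_neg a_minus_def)

lemma norm_metric: "Metric_space (carrier X) (norm_dist X)"
proof
  fix x y z
  show "0 \<le> norm_dist X x y"
    by (simp add: norm_dist_def nrm_nonneg)
  have "y \<ominus> x = \<ominus> (x \<ominus> y)" if "x \<in> carrier X" "y \<in> carrier X"
    using that by (simp add: a_minus_def M.minus_add M.a_comm)
  then show "norm_dist X x y = norm_dist X y x"
    by (simp add: norm_dist_def)
  assume x: "x \<in> carrier X" and y: "y \<in> carrier X"
  show "norm_dist X x y = 0 \<longleftrightarrow> x = y"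
    using x y by (simp add: norm_dist_def nrm_eq_0_iff diff_eq_0_iff)
  assume z: "z \<in> carrier X"
  have "x \<ominus> z = (x \<ominus> y) \<oplus> (y \<ominus> z)"
    using x y z by (simp add: a_minus_def M.a_assoc M.r_neg1)
  then show "norm_dist X x z \<le> norm_dist X x y + norm_dist X y z"
    using x y z nrm_triangle[of "x \<ominus> y" "y \<ominus> z"] by (simp add: norm_dist_def)
qed

lemma limitin_norm_topology:
  assumes "\<And>n. x n \<in> carrier X"
  shows "limitin (norm_topology X) x l sequentially \<longleftrightarrow>
    l \<in> carrier X \<and> (\<lambda>n. nrm X (x n \<ominus>\<^bsub>X\<^esub> l)) \<longlonglongrightarrow> 0"
  unfolding norm_topology_def Metric_space.limitin_metric[OF norm_metric] tendsto_iff
  using assms by (auto simp: norm_dist_def nrm_nonneg abs_of_nonneg)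

lemma norm_closure_iff:
  assumes "S \<subseteq> carrier X"
  shows "x \<in> norm_topology X closure_of S \<longleftrightarrow>
    x \<in> carrier X \<and> (\<forall>r>0. \<exists>y\<in>S. nrm X (y \<ominus>\<^bsub>X\<^esub> x) < r)"
proof -
  interpret Metric_space "carrier X" "norm_dist X"
    by (rule norm_metric)
  have "y \<in> mball x r \<longleftrightarrow> nrm X (y \<ominus>\<^bsub>X\<^esub> x) < r" if "y \<in> S" "x \<in> carrier X" for y r
    using that assms commute[of x y] by (auto simp: mball_def norm_dist_def)
  then show ?thesis
    unfolding norm_topology_def metric_closure_of by blast
qed

end

lemma normed_space_scalar_space:
  assumes "K = \<real> \<or> K = UNIV"
  shows "normed_space K (scalar_space K)"
proof (intro normed_space.intro normed_space_axioms.intro module.intro abelian_group.axioms)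
  show "cring (scalar_ring K)"
    by (rule scalar_ring_cring[OF assms])
  show "abelian_group (scalar_space K)"
  proof (rule abelian_groupI)
    fix x assume "x \<in> carrier (scalar_space K)"
    then show "\<exists>y\<in>carrier (scalar_space K). y \<oplus>\<^bsub>scalar_space K\<^esub> x = \<zero>\<^bsub>scalar_space K\<^esub>"
      using assms by (intro bexI[of _ "- x"]) auto
  qed (use assms in auto)
  show "module_axioms (scalar_ring K) (scalar_space K)"
    by standard (use assms in \<open>auto simp: algebra_simps\<close>)
qed (use assms in \<open>auto simp: norm_mult norm_triangle_ineq\<close>)

section \<open>Bounded operators\<close>

lemma (in normed_space) zero_in_unit_ball: "\<zero> \<in> unit_ball X"
  by (simp add: unit_ball_def)

lemma (in normed_space) smult_unit_ball:
  "c \<in> K \<Longrightarrow> cmod c \<le> 1 \<Longrightarrow> x \<in> unit_ball X \<Longrightarrow> c \<odot> x \<in> unit_ball X"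
  by (auto simp: unit_ball_def nrm_smult nrm_nonneg intro!: mult_le_one)

lemma unit_ball_carrier: "x \<in> unit_ball X \<Longrightarrow> x \<in> carrier X"
  by (simp add: unit_ball_def)

lemma unit_sphere_ball: "x \<in> unit_sphere X \<Longrightarrow> x \<in> unit_ball X"
  by (simp add: unit_ball_def unit_sphere_def)

lemma (in normed_space) normalize:
  assumes "x \<in> carrier X"
  shows "x \<noteq> \<zero> \<Longrightarrow> of_real (inverse (nrm X x)) \<odot> x \<in> unit_sphere X"
    and "x \<noteq> \<zero> \<Longrightarrow> of_real (nrm X x) \<odot> (of_real (inverse (nrm X x)) \<odot> x) = x"
  using assms nrm_eq_0_iff[OF assms] nrm_nonneg[OF assms]
  by (auto simp: unit_sphere_def nrm_smult smult_smult norm_inverse)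

locale normed_space_pair = dom: normed_space K X + cod: normed_space K Y for K X Y
begin

lemma bounded_operatorI:
  assumes "\<And>x. x \<in> carrier X \<Longrightarrow> T x \<in> carrier Y" "T \<in> extensional (carrier X)"
    and "\<And>x y. x \<in> carrier X \<Longrightarrow> y \<in> carrier X \<Longrightarrow> T (x \<oplus>\<^bsub>X\<^esub> y) = T x \<oplus>\<^bsub>Y\<^esub> T y"
    and "\<And>c x. c \<in> K \<Longrightarrow> x \<in> carrier X \<Longrightarrow> T (c \<odot>\<^bsub>X\<^esub> x) = c \<odot>\<^bsub>Y\<^esub> T x"
    and "\<And>x. x \<in> carrier X \<Longrightarrow> nrm Y (T x) \<le> C * nrm X x"
  shows "T \<in> bounded_operators K X Y"
  using assms unfolding bounded_operators_def PiE_def by blast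

context
  fixes T
  assumes T: "T \<in> bounded_operators K X Y"
begin

lemma operator_closed: "x \<in> carrier X \<Longrightarrow> T x \<in> carrier Y"
  using T by (auto simp: bounded_operators_def)

lemma operator_extensional: "T \<in> extensional (carrier X)"
  using T by (auto simp: bounded_operators_def PiE_def)

lemma operator_add:
  "x \<in> carrier X \<Longrightarrow> y \<in> carrier X \<Longrightarrow> T (x \<oplus>\<^bsub>X\<^esub> y) = T x \<oplus>\<^bsub>Y\<^esub> T y"
  using T by (auto simp: bounded_operators_def)

lemma operator_smult: "c \<in> K \<Longrightarrow> x \<in> carrier X \<Longrightarrow> T (c \<odot>\<^bsub>X\<^esub> x) = c \<odot>\<^bsub>Y\<^esub> T x"
  using T by (auto simp: bounded_operators_def)

lemma operator_zero: "T \<zero>\<^bsub>X\<^esub> = \<zero>\<^bsub>Y\<^esub>"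
  using operator_smult[of 0 "\<zero>\<^bsub>X\<^esub>"] operator_closed[of "\<zero>\<^bsub>X\<^esub>"] by simp

lemma operator_norm_bdd: "bdd_above ((\<lambda>x. nrm Y (T x)) ` unit_ball X)"
proof -
  obtain C where C: "\<forall>x\<in>carrier X. nrm Y (T x) \<le> C * nrm X x"
    using T by (auto simp: bounded_operators_def)
  have "nrm Y (T x) \<le> \<bar>C\<bar>" if "x \<in> unit_ball X" for x
  proof -
    have "nrm Y (T x) \<le> C * nrm X x" "0 \<le> nrm X x" "nrm X x \<le> 1"
      using that C dom.nrm_nonneg by (auto simp: unit_ball_def)
    moreover have "C * nrm X x \<le> \<bar>C\<bar> * 1"
      using calculation by (intro mult_mono) auto
    ultimately show ?thesis by simp
  qed
  then show ?thesis by (intro bdd_aboveI2)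
qed

lemma operator_norm_ball: "x \<in> unit_ball X \<Longrightarrow> nrm Y (T x) \<le> operator_norm X Y T"
  unfolding operator_norm_def by (rule cSUP_upper[OF _ operator_norm_bdd])

lemma operator_norm_nonneg: "0 \<le> operator_norm X Y T"
  using operator_norm_ball[OF dom.zero_in_unit_ball] by (simp add: operator_zero)

lemma operator_norm_bound:
  assumes "x \<in> carrier X"
  shows "nrm Y (T x) \<le> operator_norm X Y T * nrm X x"
proof (cases "x = \<zero>\<^bsub>X\<^esub>")
  case False
  then have "0 < nrm X x"
    using assms dom.nrm_nonneg dom.nrm_eq_0_iff by fastforce
  moreover have "nrm Y (T (of_real (inverse (nrm X x)) \<odot>\<^bsub>X\<^esub> x)) \<le> operator_norm X Y T"
    using False assms by (intro operator_norm_ball unit_sphere_ball dom.normalize)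
  ultimately show ?thesis
    using assms
    by (simp add: operator_smult operator_closed cod.nrm_smult norm_inverse)
      (simp add: field_simps)
qed (simp add: operator_zero)

lemma operator_norm_approx:
  assumes "s < operator_norm X Y T"
  obtains x where "x \<in> unit_ball X" "s < nrm Y (T x)"
  using assms dom.zero_in_unit_ball less_cSUP_iff[OF _ operator_norm_bdd]
  unfolding operator_norm_def by blast

text \<open>
  A vector of the ball with large image may be blown up to norm one, which only enlarges its image; if
  it is zero, the bound \<open>s\<close> is negative and every unit vector will do.
\<close>

lemma operator_norm_approx_sphere:
  assumes "s < operator_norm X Y T" "carrier X \<noteq> {\<zero>\<^bsub>X\<^esub>}"
  obtains x where "x \<in> unit_sphere X" "s < nrm Y (T x)"
proof -
  obtain x where x: "x \<in> unit_ball X" "s < nrm Y (T x)"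
    using operator_norm_approx[OF assms(1)] .
  show thesis
  proof (cases "x = \<zero>\<^bsub>X\<^esub>")
    case True
    obtain z where z: "z \<in> carrier X" "z \<noteq> \<zero>\<^bsub>X\<^esub>"
      using assms(2) dom.M.zero_closed by blast
    let ?z = "of_real (inverse (nrm X z)) \<odot>\<^bsub>X\<^esub> z"
    have "?z \<in> unit_sphere X"
      using z by (rule dom.normalize)
    moreover have "s < nrm Y (T ?z)"
      using x True z cod.nrm_nonneg[OF operator_closed[of ?z]] by (simp add: operator_zero)
    ultimately show thesis by (rule that)
  next
    case False
    let ?c = "of_real (inverse (nrm X x))" 
    have xc: "x \<in> carrier X" "nrm X x \<le> 1"
      using x by (auto simp: unit_ball_def)
    then have "0 < nrm X x"
      using False dom.nrm_nonneg[of x] dom.nrm_eq_0_iff[of x] by auto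
    then have "1 \<le> inverse (nrm X x)"
      using xc by (simp add: one_le_inverse)
    then have "nrm Y (T x) \<le> inverse (nrm X x) * nrm Y (T x)"
      using cod.nrm_nonneg[OF operator_closed[OF xc(1)]] mult_right_mono by fastforce
    also have "\<dots> = nrm Y (T (?c \<odot>\<^bsub>X\<^esub> x))"
      using xc \<open>0 < nrm X x\<close> by (simp add: operator_smult operator_closed cod.nrm_smult norm_inverse)
    finally have "s < nrm Y (T (?c \<odot>\<^bsub>X\<^esub> x))"
      using x by simp
    then show thesis
      using that dom.normalize(1)[OF xc(1) False] by blast
  qed
qed

end

lemma operator_norm_le:
  assumes "\<And>x. x \<in> unit_ball X \<Longrightarrow> nrm Y (T x) \<le> c"
  shows "operator_norm X Y T \<le> c"
  unfolding operator_norm_def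
  using assms dom.zero_in_unit_ball by (intro cSUP_least) auto

lemma operator_eqI:
  assumes "S \<in> bounded_operators K X Y" "T \<in> bounded_operators K X Y"
    and "\<And>x. x \<in> carrier X \<Longrightarrow> S x = T x"
  shows "S = T"
  using assms operator_extensional by (intro extensionalityI)

lemma operator_space_add_closed:
  assumes S: "S \<in> bounded_operators K X Y" and T: "T \<in> bounded_operators K X Y"
  shows "S \<oplus>\<^bsub>operator_space K X Y\<^esub> T \<in> bounded_operators K X Y"
proof (rule bounded_operatorI[where C = "operator_norm X Y S + operator_norm X Y T"])
  fix x assume x: "x \<in> carrier X"
  then show "nrm Y ((S \<oplus>\<^bsub>operator_space K X Y\<^esub> T) x)
      \<le> (operator_norm X Y S + operator_norm X Y T) * nrm X x"
    using cod.nrm_triangle[of "S x" "T x"] operator_closed[OF S x] operator_closed[OF T x]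
      operator_norm_bound[OF S x] operator_norm_bound[OF T x]
    by (simp add: distrib_right)
qed (simp_all add: operator_closed[OF S] operator_closed[OF T] operator_add[OF S] operator_add[OF T]
  operator_smult[OF S] operator_smult[OF T] cod.smult_add_right cod.M.a_ac)

lemma operator_space_smult_closed:
  assumes c: "c \<in> K" and T: "T \<in> bounded_operators K X Y"
  shows "c \<odot>\<^bsub>operator_space K X Y\<^esub> T \<in> bounded_operators K X Y"
proof (rule bounded_operatorI[where C = "cmod c * operator_norm X Y T"])
  fix x assume x: "x \<in> carrier X"
  then show "nrm Y ((c \<odot>\<^bsub>operator_space K X Y\<^esub> T) x) \<le> cmod c * operator_norm X Y T * nrm X x"
    using operator_norm_bound[OF T x] c
    by (simp add: cod.nrm_smult operator_closed[OF T] mult.assoc mult_left_mono)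
qed (simp_all add: c operator_closed[OF T] operator_add[OF T]
  operator_smult[OF T] cod.smult_add_right cod.smult_smult mult.commute)

lemma zero_operator: "(\<lambda>x\<in>carrier X. \<zero>\<^bsub>Y\<^esub>) \<in> bounded_operators K X Y"
  by (rule bounded_operatorI[where C = 0]) simp_all

text \<open>
  This is used both for operators into \<open>Y\<close> and, with the scalars as codomain, for dual spaces.
\<close>

lemma normed_space_operator_space: "normed_space K (operator_space K X Y)"
proof (intro normed_space.intro normed_space_axioms.intro module.intro)
  let ?L = "operator_space K X Y"
  note closed = operator_space_add_closed operator_space_smult_closed zero_operator
  show "cring (scalar_ring K)"
    by (rule scalar_ring_cring[OF dom.scalars])
  show "abelian_group ?L"
  proof (rule abelian_groupI)
    fix S T U assume *: "S \<in> carrier ?L" "T \<in> carrier ?L" "U \<in> carrier ?L"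
    show "(S \<oplus>\<^bsub>?L\<^esub> T) \<oplus>\<^bsub>?L\<^esub> U = S \<oplus>\<^bsub>?L\<^esub> (T \<oplus>\<^bsub>?L\<^esub> U)"
      using * by (auto simp: fun_eq_iff operator_closed cod.M.a_assoc)
  next
    fix S T assume *: "S \<in> carrier ?L" "T \<in> carrier ?L"
    show "S \<oplus>\<^bsub>?L\<^esub> T = T \<oplus>\<^bsub>?L\<^esub> S"
      using * by (auto simp: fun_eq_iff operator_closed cod.M.a_comm)
    show "S \<oplus>\<^bsub>?L\<^esub> T \<in> carrier ?L"
      using * closed by simp
  next
    fix T assume *: "T \<in> carrier ?L"
    show "\<zero>\<^bsub>?L\<^esub> \<oplus>\<^bsub>?L\<^esub> T = T"
      using * closed(1)[OF closed(3), of T] by (intro operator_eqI) (auto simp: operator_closed)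
    show "\<exists>S\<in>carrier ?L. S \<oplus>\<^bsub>?L\<^esub> T = \<zero>\<^bsub>?L\<^esub>"
    proof (intro bexI[of _ "(-1) \<odot>\<^bsub>?L\<^esub> T"])
      show "(-1) \<odot>\<^bsub>?L\<^esub> T \<oplus>\<^bsub>?L\<^esub> T = \<zero>\<^bsub>?L\<^esub>"
        using * by (auto simp: fun_eq_iff operator_closed cod.minus_eq_smult[symmetric] cod.M.l_neg)
      show "(-1) \<odot>\<^bsub>?L\<^esub> T \<in> carrier ?L"
        using * closed(2)[of "-1" T] by simp
    qed
  qed (use closed in auto)
  show "module_axioms (scalar_ring K) ?L"
  proof
    fix a b T assume *: "a \<in> carrier (scalar_ring K)" "b \<in> carrier (scalar_ring K)" "T \<in> carrier ?L"
    show "(a \<oplus>\<^bsub>scalar_ring K\<^esub> b) \<odot>\<^bsub>?L\<^esub> T = a \<odot>\<^bsub>?L\<^esub> T \<oplus>\<^bsub>?L\<^esub> b \<odot>\<^bsub>?L\<^esub> T"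
      using * by (auto simp: fun_eq_iff operator_closed cod.smult_add_left)
    show "(a \<otimes>\<^bsub>scalar_ring K\<^esub> b) \<odot>\<^bsub>?L\<^esub> T = a \<odot>\<^bsub>?L\<^esub> (b \<odot>\<^bsub>?L\<^esub> T)"
      using * by (auto simp: fun_eq_iff operator_closed cod.smult_smult)
  next
    fix a S T assume *: "a \<in> carrier (scalar_ring K)" "S \<in> carrier ?L" "T \<in> carrier ?L"
    show "a \<odot>\<^bsub>?L\<^esub> (S \<oplus>\<^bsub>?L\<^esub> T) = a \<odot>\<^bsub>?L\<^esub> S \<oplus>\<^bsub>?L\<^esub> a \<odot>\<^bsub>?L\<^esub> T"
      using * by (auto simp: fun_eq_iff operator_closed cod.smult_add_right)
  next
    fix T assume *: "T \<in> carrier ?L"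
    show "\<one>\<^bsub>scalar_ring K\<^esub> \<odot>\<^bsub>?L\<^esub> T = T"
      using * closed(2)[of 1 T] by (intro operator_eqI) (auto simp: operator_closed)
  qed (use closed in auto)
next
  let ?L = "operator_space K X Y"
  fix T assume "T \<in> carrier ?L"
  then have T: "T \<in> bounded_operators K X Y" by simp
  show "0 \<le> nrm ?L T"
    using operator_norm_nonneg[OF T] by simp
  show "nrm ?L T = 0 \<longleftrightarrow> T = \<zero>\<^bsub>?L\<^esub>"
  proof
    assume "nrm ?L T = 0"
    then have "T x = \<zero>\<^bsub>Y\<^esub>" if "x \<in> carrier X" for x
      using operator_norm_bound[OF T that] operator_closed[OF T that] cod.nrm_nonneg[of "T x"]
        cod.nrm_eq_0_iff[of "T x"] by simp
    then show "T = \<zero>\<^bsub>?L\<^esub>"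
      using zero_operator T by (intro operator_eqI) auto
  next
    assume "T = \<zero>\<^bsub>?L\<^esub>"
    then have "operator_norm X Y T \<le> 0"
      by (intro operator_norm_le) (simp add: unit_ball_def)
    then show "nrm ?L T = 0"
      using operator_norm_nonneg[OF T] by simp
  qed
  fix c assume c: "c \<in> K"
  have cT: "c \<odot>\<^bsub>?L\<^esub> T \<in> bounded_operators K X Y"
    by (rule operator_space_smult_closed[OF c T])
  have val: "nrm Y ((c \<odot>\<^bsub>?L\<^esub> T) x) = cmod c * nrm Y (T x)" if "x \<in> unit_ball X" for x
    using that c by (simp add: unit_ball_def cod.nrm_smult operator_closed[OF T])
  show "nrm ?L (c \<odot>\<^bsub>?L\<^esub> T) = cmod c * nrm ?L T"
  proof (rule antisym)
    show "nrm ?L (c \<odot>\<^bsub>?L\<^esub> T) \<le> cmod c * nrm ?L T"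
      unfolding operator_space_simps(5)
      by (rule operator_norm_le)
        (use operator_norm_ball[OF T] in \<open>simp only: val mult_left_mono norm_ge_zero\<close>)
    show "cmod c * nrm ?L T \<le> nrm ?L (c \<odot>\<^bsub>?L\<^esub> T)"
    proof (cases "c = 0")
      case True
      then show ?thesis
        using operator_norm_nonneg[OF cT] by simp
    next
      case False
      have "operator_norm X Y T \<le> operator_norm X Y (c \<odot>\<^bsub>?L\<^esub> T) / cmod c"
        using False operator_norm_ball[OF cT] val
        by (intro operator_norm_le) (simp add: field_simps del: operator_space_simps)
      then show ?thesis
        using False by (simp add: field_simps)
    qed
  qed
next
  let ?L = "operator_space K X Y"
  fix S T assume "S \<in> carrier ?L" "T \<in> carrier ?L"
  then have S: "S \<in> bounded_operators K X Y" and T: "T \<in> bounded_operators K X Y" by auto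
  show "nrm ?L (S \<oplus>\<^bsub>?L\<^esub> T) \<le> nrm ?L S + nrm ?L T"
    unfolding operator_space_simps(5)
  proof (rule operator_norm_le)
    fix x assume x: "x \<in> unit_ball X"
    then have xc: "x \<in> carrier X" by (rule unit_ball_carrier)
    show "nrm Y ((S \<oplus>\<^bsub>?L\<^esub> T) x) \<le> operator_norm X Y S + operator_norm X Y T"
      using xc cod.nrm_triangle[OF operator_closed[OF S xc] operator_closed[OF T xc]]
        operator_norm_ball[OF S x] operator_norm_ball[OF T x] by simp
  qed
qed (rule dom.scalars)

lemma operator_space_diff:
  assumes S: "S \<in> bounded_operators K X Y" and T: "T \<in> bounded_operators K X Y" 
    and x: "x \<in> carrier X"
  shows "(S \<ominus>\<^bsub>operator_space K X Y\<^esub> T) x = S x \<ominus>\<^bsub>Y\<^esub> T x"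
proof -
  interpret op: normed_space K "operator_space K X Y"
    by (rule normed_space_operator_space)
  show ?thesis
    using op.diff_eq_smult[of S T] S T x
    by (simp add: cod.diff_eq_smult operator_closed[OF S] operator_closed[OF T])
qed

end

section \<open>The Hahn--Banach theorem\<close>

lemma cnj_sgn_mult: "cnj (sgn z) * z = of_real (cmod z)"
proof (cases "z = 0")
  case False
  have "cnj (sgn z) * z = (z * cnj z) / of_real (cmod z)"
    by (simp add: sgn_eq mult.commute)
  also have "\<dots> = of_real (cmod z)"
    using False by (simp only: complex_norm_square[symmetric] power2_eq_square of_real_mult) simp
  finally show ?thesis .
qed simp

definition sublinear :: "'a nmodule \<Rightarrow> ('a \<Rightarrow> real) \<Rightarrow> bool" where
  "sublinear X q \<longleftrightarrow>
    (\<forall>x\<in>carrier X. \<forall>y\<in>carrier X. q (x \<oplus>\<^bsub>X\<^esub> y) \<le> q x + q y) \<and>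
    (\<forall>r>0. \<forall>x\<in>carrier X. q (of_real r \<odot>\<^bsub>X\<^esub> x) = r * q x)"

text \<open>
  The largest sublinear functional below \<open>q\<close> whose value at \<open>- a\<close> is at most \<open>- q a\<close>. The value 0 outside the
  carrier lets such functionals be compared on the whole type, where the pointwise order is antisymmetric.
\<close>

definition sublinear_shift :: "'a nmodule \<Rightarrow> 'a \<Rightarrow> ('a \<Rightarrow> real) \<Rightarrow> 'a \<Rightarrow> real" where
  "sublinear_shift X a q x =
    (if x \<in> carrier X then INF t\<in>{0..}. q (x \<oplus>\<^bsub>X\<^esub> of_real t \<odot>\<^bsub>X\<^esub> a) - t * q a else 0)"

context normed_space
begin

text \<open>
  The inequality in the second premise, applied to \<open>inverse r\<close>, gives the reverse one.
\<close>

lemma sublinearI: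
  assumes add: "\<And>x y. x \<in> carrier X \<Longrightarrow> y \<in> carrier X \<Longrightarrow> q (x \<oplus> y) \<le> q x + q y"
    and smult: "\<And>r x. 0 < r \<Longrightarrow> x \<in> carrier X \<Longrightarrow> q (of_real r \<odot> x) \<le> r * q x"
  shows "sublinear X q"
  unfolding sublinear_def
proof (intro conjI ballI allI impI antisym add smult)
  fix r :: real and x assume r: "0 < r" and x: "x \<in> carrier X"
  have "q (of_real (inverse r) \<odot> (of_real r \<odot> x)) \<le> inverse r * q (of_real r \<odot> x)"
    using r x by (intro smult) auto
  moreover have "of_real (inverse r) \<odot> (of_real r \<odot> x) = x"
    using r x by (simp add: smult_smult)
  ultimately show "r * q x \<le> q (of_real r \<odot> x)"
    using r by (simp add: field_simps)
qed

context
  fixes q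
  assumes q: "sublinear X q"
begin

lemma sublinear_add: "x \<in> carrier X \<Longrightarrow> y \<in> carrier X \<Longrightarrow> q (x \<oplus> y) \<le> q x + q y"
  using q by (auto simp: sublinear_def)

lemma sublinear_zero: "q \<zero> = 0"
  using q[unfolded sublinear_def, THEN conjunct2, rule_format, of 2 \<zero>] smult_r_null[of "2::complex"]
    scalar_closed(3)[of 2] by simp

lemma sublinear_smult: "0 \<le> r \<Longrightarrow> x \<in> carrier X \<Longrightarrow> q (of_real r \<odot> x) = r * q x"
  using q by (cases "r = 0") (auto simp: sublinear_def sublinear_zero)

lemma sublinear_minus: "x \<in> carrier X \<Longrightarrow> - q (\<ominus> x) \<le> q x"
  using sublinear_add[of x "\<ominus> x"] by (simp add: M.r_neg sublinear_zero)

context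
  fixes a
  assumes a: "a \<in> carrier X"
begin

lemma sublinear_shift_bdd:
  assumes "x \<in> carrier X"
  shows "bdd_below ((\<lambda>t. q (x \<oplus> of_real t \<odot> a) - t * q a) ` {0..})"
proof (rule bdd_belowI2)
  fix t :: real assume "t \<in> {0..}"
  then have t: "0 \<le> t" by simp
  have "t * q a = q ((x \<oplus> of_real t \<odot> a) \<oplus> \<ominus> x)"
    using t a assms sublinear_smult by (simp add: M.a_ac M.r_neg2 M.r_neg1)
  also have "\<dots> \<le> q (x \<oplus> of_real t \<odot> a) + q (\<ominus> x)"
    using a assms by (intro sublinear_add) auto
  finally show "- q (\<ominus> x) \<le> q (x \<oplus> of_real t \<odot> a) - t * q a" by simp
qed

lemma sublinear_shift_le:
  assumes "x \<in> carrier X" "0 \<le> t"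
  shows "sublinear_shift X a q x \<le> q (x \<oplus> of_real t \<odot> a) - t * q a"
  using cINF_lower[OF sublinear_shift_bdd[OF assms(1)], of t] assms
  by (simp add: sublinear_shift_def)

lemma sublinear_shift_greatest:
  assumes "x \<in> carrier X" "\<And>t. 0 \<le> t \<Longrightarrow> c \<le> q (x \<oplus> of_real t \<odot> a) - t * q a"
  shows "c \<le> sublinear_shift X a q x"
  using assms by (auto simp: sublinear_shift_def intro!: cINF_greatest)

lemma sublinear_shift_le_self: "x \<in> carrier X \<Longrightarrow> sublinear_shift X a q x \<le> q x"
  using sublinear_shift_le[of x 0] a by simp

lemma sublinear_shift_sublinear: "sublinear X (sublinear_shift X a q)"
proof (rule sublinearI)
  let ?s = "sublinear_shift X a q"
  fix x y assume x: "x \<in> carrier X" and y: "y \<in> carrier X"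
  have *: "?s (x \<oplus> y) \<le> (q (x \<oplus> of_real t \<odot> a) - t * q a) + (q (y \<oplus> of_real s \<odot> a) - s * q a)"
    if "0 \<le> t" "0 \<le> s" for t s
  proof -
    have eq: "(x \<oplus> y) \<oplus> of_real (t + s) \<odot> a = (x \<oplus> of_real t \<odot> a) \<oplus> (y \<oplus> of_real s \<odot> a)"
      using x y a by (simp add: smult_add_left M.a_ac)
    have "?s (x \<oplus> y) \<le> q ((x \<oplus> y) \<oplus> of_real (t + s) \<odot> a) - (t + s) * q a"
      using x y that by (intro sublinear_shift_le) auto
    also have "q ((x \<oplus> y) \<oplus> of_real (t + s) \<odot> a) \<le> q (x \<oplus> of_real t \<odot> a) + q (y \<oplus> of_real s \<odot> a)"
      unfolding eq using x y a by (intro sublinear_add) auto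
    finally show ?thesis by (simp add: algebra_simps)
  qed
  have "?s (x \<oplus> y) - (q (x \<oplus> of_real t \<odot> a) - t * q a) \<le> ?s y" if "0 \<le> t" for t
    by (rule sublinear_shift_greatest[OF y]) (use *[OF that] in \<open>simp add: algebra_simps\<close>)
  then have "?s (x \<oplus> y) - ?s y \<le> ?s x"
    by (intro sublinear_shift_greatest[OF x]) (simp add: algebra_simps)
  then show "?s (x \<oplus> y) \<le> ?s x + ?s y" by simp
next
  let ?s = "sublinear_shift X a q"
  fix r :: real and x assume r: "0 < r" and x: "x \<in> carrier X"
  have "inverse r * ?s (of_real r \<odot> x) \<le> ?s x"
  proof (rule sublinear_shift_greatest[OF x])
    fix t :: real assume t: "0 \<le> t"
    have eq: "of_real r \<odot> x \<oplus> of_real (r * t) \<odot> a = of_real r \<odot> (x \<oplus> of_real t \<odot> a)"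
      using x a by (simp add: smult_add_right smult_smult)
    have "?s (of_real r \<odot> x) \<le> q (of_real r \<odot> x \<oplus> of_real (r * t) \<odot> a) - (r * t) * q a"
      using x r t by (intro sublinear_shift_le) auto
    also have "\<dots> = r * (q (x \<oplus> of_real t \<odot> a) - t * q a)"
      unfolding eq using r x a by (subst sublinear_smult) (auto simp: algebra_simps)
    finally show "inverse r * ?s (of_real r \<odot> x) \<le> q (x \<oplus> of_real t \<odot> a) - t * q a"
      using r by (simp add: field_simps)
  qed
  then show "?s (of_real r \<odot> x) \<le> r * ?s x"
    using r by (simp add: field_simps)
qed

lemma sublinear_shift_minus: "sublinear_shift X a q (\<ominus> a) \<le> - q a"
  using sublinear_shift_le[of "\<ominus> a" 1] a by (simp add: M.l_neg sublinear_zero)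

end

end

lemma sublinear_nrm: "sublinear X (nrm X)"
  by (rule sublinearI) (auto simp: nrm_triangle nrm_smult)

text \<open>
  A minimal sublinear functional \<open>q\<close> is additive: the shift of \<open>q\<close> by \<open>y\<close> lies below \<open>q\<close>, hence equals \<open>q\<close>, and
  its defining infimum at \<open>t = 1\<close> reads \<open>q x \<le> q (x + y) - q y\<close>. Keeping \<open>q (- a) \<le> - \<parallel>a\<parallel>\<close> throughout ensures \<open>q a = \<parallel>a\<parallel>\<close>; the shift of the norm by \<open>a\<close> is a functional
  of this kind.
\<close>

lemma exists_real_linear_functional:
  assumes a: "a \<in> carrier X"
  obtains q where "\<forall>x\<in>carrier X. \<forall>y\<in>carrier X. q (x \<oplus> y) = q x + q y"
    "\<forall>r. \<forall>x\<in>carrier X. q (of_real r \<odot> x) = r * q x"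
    "\<forall>x\<in>carrier X. q x \<le> nrm X x"
    "q a = nrm X a"
proof -
  define Q where "Q = {q. (\<forall>x. x \<notin> carrier X \<longrightarrow> q x = 0) \<and> sublinear X q \<and>
    (\<forall>x\<in>carrier X. q x \<le> nrm X x) \<and> q (\<ominus> a) \<le> - nrm X a}"
  have shift_Q: "sublinear_shift X b q \<in> Q" if qQ: "q \<in> Q" and b: "b \<in> carrier X" for q b
  proof -
    have q: "sublinear X q" "\<forall>x\<in>carrier X. q x \<le> nrm X x" "q (\<ominus> a) \<le> - nrm X a"
      using qQ by (auto simp: Q_def)
    note le = sublinear_shift_le_self[OF q(1) b]
    have "sublinear_shift X b q x \<le> nrm X x" if "x \<in> carrier X" for x
      using le[OF that] q(2) that by (meson order_trans)
    moreover have "sublinear_shift X b q (\<ominus> a) \<le> - nrm X a"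
      using le[of "\<ominus> a"] a q(3) by simp
    ultimately show ?thesis
      using sublinear_shift_sublinear[OF q(1) b] by (simp add: Q_def sublinear_shift_def)
  qed
  have base: "sublinear_shift X a (nrm X) \<in> Q"
    using a sublinear_shift_sublinear[OF sublinear_nrm a] sublinear_shift_le_self[OF sublinear_nrm a]
      sublinear_shift_minus[OF sublinear_nrm a]
    unfolding Q_def by (auto simp: sublinear_shift_def)
  have "\<exists>m\<in>Q. \<forall>q\<in>Q. q \<le> m \<longrightarrow> q = m"
  proof (rule predicate_Zorn)
    show "partial_order_on Q (relation_of (\<lambda>p q. q \<le> p) Q)"
      by (rule partial_order_on_relation_ofI) auto
    fix C assume C: "C \<in> Chains (relation_of (\<lambda>p q. q \<le> p) Q)"
    show "\<exists>u\<in>Q. \<forall>p\<in>C. u \<le> p"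
    proof (cases "C = {}")
      case True
      then show ?thesis using base by auto
    next
      case False
      have CQ: "C \<subseteq> Q"
        using C by (auto simp: Chains_def relation_of_def)
      have chain: "p \<le> q \<or> q \<le> p" if "p \<in> C" "q \<in> C" for p q
        using C that by (auto simp: Chains_def relation_of_def)
      define u where "u x = (INF p\<in>C. p x)" for x
      have bdd: "bdd_below ((\<lambda>p. p x) ` C)" for x
      proof (cases "x \<in> carrier X")
        case True
        have "- nrm X x \<le> p x" if "p \<in> C" for p
        proof -
          have "p \<in> Q" using that CQ by auto
          then have "sublinear X p" "p (\<ominus> x) \<le> nrm X (\<ominus> x)"
            using True by (simp_all add: Q_def del: nrm_minus)
          then show ?thesis
            using sublinear_minus[of p x] True by simp
        qed
        then show ?thesis by (intro bdd_belowI2)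
      next
        case False
        then have "p x = 0" if "p \<in> C" for p
          using that CQ by (auto simp: Q_def)
        then show ?thesis by (intro bdd_belowI2[of _ 0]) (metis order_refl)
      qed
      have lower: "u x \<le> p x" if "p \<in> C" for p x
        unfolding u_def using bdd that by (rule cINF_lower)
      have greatest: "c \<le> u x" if "\<And>p. p \<in> C \<Longrightarrow> c \<le> p x" for c x
        unfolding u_def using False that by (rule cINF_greatest)
      obtain p0 where p0: "p0 \<in> C" using False by auto
      then have p0Q: "\<forall>x\<in>carrier X. p0 x \<le> nrm X x" "p0 (\<ominus> a) \<le> - nrm X a"
        using CQ by (auto simp: Q_def)
      have "sublinear X u"
      proof (rule sublinearI)
        fix x y assume x: "x \<in> carrier X" and y: "y \<in> carrier X"
        \<comment> \<open>The infimum of a chain is subadditive because two members of the chain have a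
          common lower bound in it.\<close>
        have *: "u (x \<oplus> y) \<le> p x + q y" if pq: "p \<in> C" "q \<in> C" for p q
        proof -
          obtain m where m: "m \<in> C" "m \<le> p" "m \<le> q"
            using chain[OF pq] pq by auto
          have "sublinear X m" using m(1) CQ by (auto simp: Q_def)
          then have "u (x \<oplus> y) \<le> m x + m y"
            using lower[OF m(1), of "x \<oplus> y"] sublinear_add[of m x y] x y by simp
          also have "\<dots> \<le> p x + q y"
            using m by (intro add_mono) (auto simp: le_fun_def)
          finally show ?thesis .
        qed
        have "u (x \<oplus> y) - p x \<le> u y" if "p \<in> C" for p
          by (rule greatest) (use *[OF that] in \<open>simp add: algebra_simps\<close>)
        then have "u (x \<oplus> y) - u y \<le> u x"
          by (intro greatest) (simp add: algebra_simps)
        then show "u (x \<oplus> y) \<le> u x + u y" by simp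
      next
        fix r :: real and x assume r: "0 < r" and x: "x \<in> carrier X"
        have "inverse r * u (of_real r \<odot> x) \<le> u x"
        proof (rule greatest)
          fix p assume p: "p \<in> C"
          then have "p (of_real r \<odot> x) = r * p x"
            using CQ r x by (auto simp: Q_def sublinear_def)
          then show "inverse r * u (of_real r \<odot> x) \<le> p x"
            using lower[OF p, of "of_real r \<odot> x"] r by (simp add: field_simps)
        qed
        then show "u (of_real r \<odot> x) \<le> r * u x"
          using r by (simp add: field_simps)
      qed
      moreover have "u x = 0" if "x \<notin> carrier X" for x
      proof -
        have "p x = 0" if "p \<in> C" for p
          using that CQ \<open>x \<notin> carrier X\<close> by (auto simp: Q_def)
        then have "u x = (INF p\<in>C. (0::real))"
          unfolding u_def by (intro INF_cong) auto
        then show ?thesis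
          using False by simp
      qed
      moreover have "u x \<le> nrm X x" if "x \<in> carrier X" for x
        using lower[OF p0, of x] p0Q that by force
      moreover have "u (\<ominus> a) \<le> - nrm X a"
        using lower[OF p0, of "\<ominus> a"] p0Q by simp
      ultimately have "u \<in> Q"
        by (auto simp: Q_def)
      then show ?thesis
        using lower by (auto simp: le_fun_def)
    qed
  qed
  then obtain q where qQ: "q \<in> Q" and min: "\<And>p. p \<in> Q \<Longrightarrow> p \<le> q \<Longrightarrow> p = q" by blast
  then have q: "sublinear X q" and le: "\<And>x. x \<in> carrier X \<Longrightarrow> q x \<le> nrm X x"
    and qa: "q (\<ominus> a) \<le> - nrm X a" and out: "\<And>x. x \<notin> carrier X \<Longrightarrow> q x = 0"
    by (auto simp: Q_def)
  have add: "q (x \<oplus> y) = q x + q y" if x: "x \<in> carrier X" and y: "y \<in> carrier X" for x y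
  proof (rule antisym)
    show "q (x \<oplus> y) \<le> q x + q y"
      by (rule sublinear_add[OF q x y])
    have "sublinear_shift X y q = q"
      using shift_Q[OF qQ y] sublinear_shift_le_self[OF q y] out
      by (intro min) (auto simp: le_fun_def sublinear_shift_def)
    then have "q x \<le> q (x \<oplus> y) - q y"
      using sublinear_shift_le[OF q y x, of 1] y by simp
    then show "q x + q y \<le> q (x \<oplus> y)" by simp
  qed
  have minus: "q (\<ominus> x) = - q x" if "x \<in> carrier X" for x
    using add[of x "\<ominus> x"] that by (simp add: M.r_neg sublinear_zero[OF q])
  have smult: "q (of_real r \<odot> x) = r * q x" if x: "x \<in> carrier X" for r x
  proof (cases "0 \<le> r")
    case True
    then show ?thesis by (rule sublinear_smult[OF q _ x])
  next
    case False
    have "of_real r \<odot> x = \<ominus> (of_real (- r) \<odot> x)"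
      using x by (simp add: minus_eq_smult smult_smult)
    then show ?thesis
      using False sublinear_smult[OF q _ x, of "- r"] x minus[of "of_real (- r) \<odot> x"] by simp
  qed
  have "q a = nrm X a"
    using qa minus[OF a] le[OF a] by simp
  then show thesis
    by (intro that[of q] ballI allI add smult le)
qed

lemma dual_simps:
  "carrier (dual K X) = bounded_operators K X (scalar_space K)"
  "nrm (dual K X) = operator_norm X (scalar_space K)"
  by (simp_all add: dual_def)

lemma dual_pair: "normed_space_pair K X (scalar_space K)"
  by (intro normed_space_pair.intro normed_space_scalar_space[OF scalars] normed_space_axioms)

lemma normed_space_dual: "normed_space K (dual K X)"
  unfolding dual_def by (rule normed_space_pair.normed_space_operator_space[OF dual_pair])

lemma functionalI:
  assumes "\<And>x. x \<in> carrier X \<Longrightarrow> f x \<in> K" "f \<in> extensional (carrier X)"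
    and "\<And>x y. x \<in> carrier X \<Longrightarrow> y \<in> carrier X \<Longrightarrow> f (x \<oplus> y) = f x + f y"
    and "\<And>c x. c \<in> K \<Longrightarrow> x \<in> carrier X \<Longrightarrow> f (c \<odot> x) = c * f x"
    and "\<And>x. x \<in> carrier X \<Longrightarrow> cmod (f x) \<le> C * nrm X x"
  shows "f \<in> carrier (dual K X)"
  unfolding dual_simps
  by (rule normed_space_pair.bounded_operatorI[OF dual_pair, where C = C]) (use assms in auto)

context
  fixes f
  assumes f: "f \<in> carrier (dual K X)"
begin

lemma functional_closed: "x \<in> carrier X \<Longrightarrow> f x \<in> K"
  using normed_space_pair.operator_closed[OF dual_pair f[unfolded dual_simps]] by simp

lemma functional_extensional: "f \<in> extensional (carrier X)"
  using normed_space_pair.operator_extensional[OF dual_pair f[unfolded dual_simps]] by simp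

lemma functional_add: "x \<in> carrier X \<Longrightarrow> y \<in> carrier X \<Longrightarrow> f (x \<oplus> y) = f x + f y"
  using normed_space_pair.operator_add[OF dual_pair f[unfolded dual_simps]] by simp

lemma functional_smult: "c \<in> K \<Longrightarrow> x \<in> carrier X \<Longrightarrow> f (c \<odot> x) = c * f x"
  using normed_space_pair.operator_smult[OF dual_pair f[unfolded dual_simps]] by simp

lemma functional_diff: "x \<in> carrier X \<Longrightarrow> y \<in> carrier X \<Longrightarrow> f (x \<ominus> y) = f x - f y"
  by (simp add: diff_eq_smult functional_add functional_smult)

lemma functional_bound: "x \<in> carrier X \<Longrightarrow> cmod (f x) \<le> nrm (dual K X) f * nrm X x"
  using normed_space_pair.operator_norm_bound[OF dual_pair f[unfolded dual_simps]]
  by (simp add: dual_simps)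

end

lemma dual_unit_ball_iff:
  "f \<in> unit_ball (dual K X) \<longleftrightarrow>
    f \<in> carrier (dual K X) \<and> (\<forall>x\<in>carrier X. cmod (f x) \<le> nrm X x)"
proof (intro iffI conjI ballI)
  fix x assume f: "f \<in> unit_ball (dual K X)" and x: "x \<in> carrier X"
  show "cmod (f x) \<le> nrm X x"
    using functional_bound[OF unit_ball_carrier[OF f] x] f nrm_nonneg[OF x]
      mult_right_mono[of "nrm (dual K X) f" 1 "nrm X x"]
    by (simp add: unit_ball_def)
next
  assume f: "f \<in> carrier (dual K X) \<and> (\<forall>x\<in>carrier X. cmod (f x) \<le> nrm X x)"
  have "nrm (dual K X) f \<le> 1"
    unfolding dual_simps
  proof (rule normed_space_pair.operator_norm_le[OF dual_pair])
    fix x assume "x \<in> unit_ball X"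
    then have "x \<in> carrier X" "nrm X x \<le> 1" by (auto simp: unit_ball_def)
    then show "nrm (scalar_space K) (f x) \<le> 1"
      using f by force
  qed
  then show "f \<in> unit_ball (dual K X)"
    using f by (simp add: unit_ball_def)
qed (rule unit_ball_carrier)

text \<open>
  Over the complex numbers, \<open>q\<close> is the real part of \<open>x \<mapsto> q x - \<i> q (\<i> x)\<close>. This functional is complex linear, and
  rotating its value at \<open>x\<close> to the positive half-axis bounds it by the bound on \<open>q\<close>.
\<close>

theorem Hahn_Banach_norming:
  assumes a: "a \<in> carrier X"
  obtains f where "f \<in> unit_ball (dual K X)" "f a = of_real (nrm X a)"
proof -
  obtain q where q: "\<forall>x\<in>carrier X. \<forall>y\<in>carrier X. q (x \<oplus> y) = q x + q y"
      "\<forall>r. \<forall>x\<in>carrier X. q (of_real r \<odot> x) = r * q x" "\<forall>x\<in>carrier X. q x \<le> nrm X x"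
    and qa: "q a = nrm X a"
    by (rule exists_real_linear_functional[OF a])
  note add = q(1)[rule_format] and smult = q(2)[rule_format] and le = q(3)[rule_format]
  show thesis
  proof (cases "K = UNIV")
    case False
    then have K: "K = \<real>" using scalars by auto
    have abs_le: "\<bar>q x\<bar> \<le> nrm X x" if "x \<in> carrier X" for x
      using le[OF that] le[of "of_real (-1) \<odot> x"] smult[OF that, of "-1"] that
      by (auto simp: nrm_smult abs_le_iff)
    have "(\<lambda>x\<in>carrier X. of_real (q x)) \<in> unit_ball (dual K X)"
      unfolding dual_unit_ball_iff
    proof
      show "(\<lambda>x\<in>carrier X. of_real (q x)) \<in> carrier (dual K X)"
        by (rule functionalI[where C = 1]) (auto simp: K add smult abs_le elim!: Reals_cases)
    qed (simp add: abs_le)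
    then show thesis
      using that a qa by force
  next
    case True
    define f where "f = (\<lambda>x\<in>carrier X. Complex (q x) (- q (\<i> \<odot> x)))"
    have f_add: "f (x \<oplus> y) = f x + f y" if "x \<in> carrier X" "y \<in> carrier X" for x y
      using that True by (simp add: f_def add smult_add_right complex_eq_iff)
    have f_smult: "f (c \<odot> x) = c * f x" if x: "x \<in> carrier X" for c x
    proof -
      have c: "c = of_real (Re c) + of_real (Im c) * \<i>"
        by (simp add: complex_eq_iff)
      have 1: "c \<odot> x = of_real (Re c) \<odot> x \<oplus> of_real (Im c) \<odot> (\<i> \<odot> x)"
        using x True by (subst c) (simp add: smult_add_left smult_smult)
      have "\<i> * c = of_real (Re c) * \<i> + of_real (- Im c)"
        by (simp add: complex_eq_iff)
      then have 2: "\<i> \<odot> (c \<odot> x) = of_real (Re c) \<odot> (\<i> \<odot> x) \<oplus> of_real (- Im c) \<odot> x"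
        using x True by (simp only: smult_smult UNIV_I smult_add_left smult_closed)
      show ?thesis
        using x True smult[OF x, of "- Im c"] by (simp add: f_def 2) (simp add: 1 add smult complex_eq_iff)
    qed
    have f_bound: "cmod (f x) \<le> nrm X x" if x: "x \<in> carrier X" for x
    proof -
      have "of_real (cmod (f x)) = cnj (sgn (f x)) * f x"
        by (simp add: cnj_sgn_mult)
      also have "\<dots> = f (cnj (sgn (f x)) \<odot> x)"
        using f_smult[OF x] by simp
      finally have "cmod (f x) = Re (f (cnj (sgn (f x)) \<odot> x))"
        by (metis Re_complex_of_real)
      also have "\<dots> = q (cnj (sgn (f x)) \<odot> x)"
        using x True by (simp add: f_def)
      also have "\<dots> \<le> nrm X (cnj (sgn (f x)) \<odot> x)"
        using x True by (intro le) auto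
      also have "\<dots> \<le> nrm X x"
        using x True nrm_nonneg[OF x] by (simp add: nrm_smult norm_sgn)
      finally show ?thesis .
    qed
    have "f \<in> carrier (dual K X)"
    proof (rule functionalI[where C = 1])
      show "f \<in> extensional (carrier X)"
        by (simp add: f_def)
    qed (use True f_add f_smult f_bound in auto)
    then have "f \<in> unit_ball (dual K X)"
      using f_bound by (simp add: dual_unit_ball_iff)
    moreover have "f a = of_real (nrm X a)"
    proof -
      have "Re (f a) = nrm X a"
        using a qa by (simp add: f_def)
      moreover have "cmod (f a) \<le> Re (f a)"
        using f_bound[OF a] calculation by simp
      ultimately show ?thesis
        using complex_Re_le_cmod[of "f a"] cmod_power2[of "f a"] by (simp add: complex_eq_iff)
    qed
    ultimately show thesis by (rule that)
  qed
qed

end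

section \<open>Weak-star compactness and extreme points of the dual ball\<close>

text \<open>
  The weak-star topology is the restriction of this one to the dual space. The dual ball is closed in
  the whole product, so compactness can be used without reference to the subspace.
\<close>

definition pointwise_topology :: "'a nmodule \<Rightarrow> ('a \<Rightarrow> complex) topology" where
  "pointwise_topology X = product_topology (\<lambda>_. euclidean) (carrier X)"

lemma continuous_map_evaluation:
  assumes "x \<in> carrier X" "continuous_on UNIV h"
  shows "continuous_map (pointwise_topology X) euclidean (\<lambda>f. h (f x))"
proof -
  have "continuous_map (pointwise_topology X) euclidean (\<lambda>f. f x)"
    unfolding pointwise_topology_def by (intro continuous_map_product_projection assms)
  moreover have "continuous_map euclidean euclidean h"
    using assms by simp
  ultimately show ?thesis
    by (rule continuous_map_compose[unfolded o_def])
qed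

lemma closedin_preimage:
  "continuous_map T euclidean g \<Longrightarrow> closedin T U \<Longrightarrow> closed C \<Longrightarrow> closedin T {f \<in> U. g f \<in> C}"
  by (rule closedin_continuous_map_preimage_gen) auto

lemma closedin_Collect_ball:
  assumes "closedin T U" "\<And>i. i \<in> A \<Longrightarrow> closedin T {f \<in> U. Q i f}"
  shows "closedin T {f \<in> U. \<forall>i\<in>A. Q i f}"
proof -
  have "{f \<in> U. \<forall>i\<in>A. Q i f} = \<Inter>(insert U ((\<lambda>i. {f \<in> U. Q i f}) ` A))"
    by auto
  moreover have "closedin T \<dots>"
    by (rule closedin_Inter) (use assms in auto)
  ultimately show ?thesis by simp
qed

text \<open>
  These are the weak-star closed extremal subsets of the dual ball, convex or not.
\<close>

definition dual_face :: "complex set \<Rightarrow> 'a nmodule \<Rightarrow> ('a \<Rightarrow> complex) set \<Rightarrow> bool" where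
  "dual_face K X F \<longleftrightarrow> F \<subseteq> unit_ball (dual K X) \<and> closedin (pointwise_topology X) F \<and>
    (\<forall>e\<in>F. \<forall>a\<in>unit_ball (dual K X). \<forall>b\<in>unit_ball (dual K X). \<forall>t::real. 0 < t \<and> t < 1 \<and>
      (\<forall>x\<in>carrier X. e x = of_real (1 - t) * a x + of_real t * b x) \<longrightarrow> a \<in> F \<and> b \<in> F)"

lemma dual_faceI:
  assumes "F \<subseteq> unit_ball (dual K X)" "closedin (pointwise_topology X) F"
    and "\<And>e a b t. \<lbrakk>e \<in> F; a \<in> unit_ball (dual K X); b \<in> unit_ball (dual K X); 0 < t; t < 1;
      \<And>x. x \<in> carrier X \<Longrightarrow> e x = of_real (1 - t) * a x + of_real t * b x\<rbrakk> \<Longrightarrow> a \<in> F \<and> b \<in> F"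
  shows "dual_face K X F"
  using assms unfolding dual_face_def by blast

lemma dual_faceD:
  assumes "dual_face K X F" "e \<in> F" "a \<in> unit_ball (dual K X)" "b \<in> unit_ball (dual K X)"
    "0 < t" "t < 1" "\<And>x. x \<in> carrier X \<Longrightarrow> e x = of_real (1 - t) * a x + of_real t * b x"
  shows "a \<in> F" "b \<in> F"
  using assms unfolding dual_face_def by blast+

context normed_space
begin

text \<open>
  Linearity, the bound by the norm and membership of the values in \<open>K\<close> are conditions on finitely many
  evaluations at a time, and each of them is closed.
\<close>

lemma closedin_dual_unit_ball: "closedin (pointwise_topology X) (unit_ball (dual K X))"
proof -
  let ?P = "pointwise_topology X"
  let ?U = "topspace ?P"
  have top: "?U = extensional (carrier X)"
    by (simp add: pointwise_topology_def PiE_UNIV_domain PiE_def)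
  have U: "closedin ?P ?U" by (rule closedin_topspace)
  have ev: "continuous_map ?P euclidean (\<lambda>f. f x)" if "x \<in> carrier X" for x
    using continuous_map_evaluation[OF that, of "\<lambda>z. z"] by simp
  have 1: "closedin ?P {f \<in> ?U. \<forall>x\<in>carrier X. f x \<in> K}"
    by (intro closedin_Collect_ball U closedin_preimage ev closed_scalars)
  have 2: "closedin ?P {f \<in> ?U. \<forall>x\<in>carrier X. cmod (f x) \<in> {..nrm X x}}"
    by (intro closedin_Collect_ball U closedin_preimage continuous_map_norm ev) auto
  have 3: "closedin ?P {f \<in> ?U. \<forall>p\<in>carrier X \<times> carrier X.
      f (fst p \<oplus> snd p) - (f (fst p) + f (snd p)) \<in> {0}}"
    by (intro closedin_Collect_ball U closedin_preimage continuous_map_diff continuous_map_add ev)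
      auto
  have 4: "closedin ?P {f \<in> ?U. \<forall>p\<in>K \<times> carrier X. f (fst p \<odot> snd p) - fst p * f (snd p) \<in> {0}}"
    by (intro closedin_Collect_ball U closedin_preimage continuous_map_diff ev
        continuous_map_evaluation continuous_intros) auto
  have "unit_ball (dual K X) = {f \<in> ?U. \<forall>x\<in>carrier X. f x \<in> K} \<inter>
    {f \<in> ?U. \<forall>x\<in>carrier X. cmod (f x) \<in> {..nrm X x}} \<inter>
    {f \<in> ?U. \<forall>p\<in>carrier X \<times> carrier X. f (fst p \<oplus> snd p) - (f (fst p) + f (snd p)) \<in> {0}} \<inter>
    {f \<in> ?U. \<forall>p\<in>K \<times> carrier X. f (fst p \<odot> snd p) - fst p * f (snd p) \<in> {0}}" (is "?B = ?R")
  proof (intro subset_antisym subsetI)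
    fix f assume f: "f \<in> ?B"
    then have fd: "f \<in> carrier (dual K X)" "\<forall>x\<in>carrier X. cmod (f x) \<le> nrm X x"
      by (auto simp: dual_unit_ball_iff)
    then show "f \<in> ?R"
      using functional_closed[OF fd(1)] functional_extensional[OF fd(1)] functional_add[OF fd(1)]
        functional_smult[OF fd(1)] by (auto simp: top)
  next
    fix f assume f: "f \<in> ?R"
    have "f \<in> carrier (dual K X)"
      by (rule functionalI[where C = 1]) (use f in \<open>auto simp: top\<close>)
    then show "f \<in> ?B"
      using f by (auto simp: dual_unit_ball_iff)
  qed
  then show ?thesis
    using 1 2 3 4 by (auto intro!: closedin_Int)
qed

theorem Banach_Alaoglu: "compactin (pointwise_topology X) (unit_ball (dual K X))"
proof (rule closed_compactin)
  show "compactin (pointwise_topology X) (PiE (carrier X) (\<lambda>x. cball 0 (nrm X x)))"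
    by (simp add: pointwise_topology_def compactin_PiE)
  show "unit_ball (dual K X) \<subseteq> (\<Pi>\<^sub>E x\<in>carrier X. cball 0 (nrm X x))"
    using functional_extensional by (auto simp: dual_unit_ball_iff PiE_def)
qed (rule closedin_dual_unit_ball)

lemma dual_unit_ball_nest:
  fixes C :: "nat \<Rightarrow> ('a \<Rightarrow> complex) set"
  assumes "\<And>n. closedin (pointwise_topology X) (C n)" "\<And>n. C n \<subseteq> unit_ball (dual K X)"
    and "\<And>n. C n \<noteq> {}" "decseq C"
  shows "(\<Inter>n. C n) \<noteq> {}"
  by (rule compact_space_imp_nest[OF compact_space_subtopology[OF Banach_Alaoglu]])
    (use assms closedin_dual_unit_ball in \<open>auto simp: closedin_closed_subtopology\<close>)

text \<open>
  If a proper convex combination takes the least value of a real linear function on \<open>F\<close>, so do both of its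
  end points.
\<close>

lemma dual_face_minimizers:
  fixes c :: complex
  assumes F: "dual_face K X F" "F \<noteq> {}" and x: "x \<in> carrier X"
  defines "G \<equiv> {f \<in> F. \<forall>g\<in>F. Re (c * f x) \<le> Re (c * g x)}"
  shows "dual_face K X G" "G \<noteq> {}"
proof -
  let ?P = "pointwise_topology X"
  have FB: "F \<subseteq> unit_ball (dual K X)" and Fc: "closedin ?P F"
    using F by (auto simp: dual_face_def)
  have cont: "continuous_map ?P euclidean (\<lambda>f. Re (c * f x))"
    by (intro continuous_map_evaluation[OF x, of "\<lambda>z. Re (c * z)"] continuous_intros)
  have "compactin ?P F"
    using closed_compactin[OF Banach_Alaoglu FB Fc] .
  then have "compact ((\<lambda>f. Re (c * f x)) ` F)"
    using image_compactin[OF _ cont] by simp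
  then obtain m where m: "m \<in> F" "\<And>g. g \<in> F \<Longrightarrow> Re (c * m x) \<le> Re (c * g x)"
    using compact_attains_inf[of "(\<lambda>f. Re (c * f x)) ` F"] F(2) by auto
  have G: "G = {f \<in> F. Re (c * f x) \<in> {..Re (c * m x)}}"
    unfolding G_def using m by (auto intro: order_trans)
  show "G \<noteq> {}"
    using m by (auto simp: G_def)
  have closedG: "closedin ?P G"
    unfolding G by (intro closedin_preimage cont Fc) auto
  have extremal: "a \<in> G \<and> b \<in> G"
    if e: "e \<in> G" and ab: "a \<in> unit_ball (dual K X)" "b \<in> unit_ball (dual K X)"
      and t: "0 < t" "t < 1"
      and eq: "\<And>x. x \<in> carrier X \<Longrightarrow> e x = of_real (1 - t) * a x + of_real t * b x"
    for e a b and t :: real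
  proof -
    have "e \<in> F" using e by (simp add: G_def)
    then have abF: "a \<in> F" "b \<in> F"
      using dual_faceD[OF F(1) _ ab t eq] by auto
    let ?u = "Re (c * a x)" and ?v = "Re (c * b x)" and ?m = "Re (c * m x)"
    have "Re (c * e x) = (1 - t) * ?u + t * ?v"
      unfolding eq[OF x] by (simp add: algebra_simps)
    then have le: "(1 - t) * ?u + t * ?v \<le> ?m"
      using e by (simp add: G)
    have uv: "?m \<le> ?u" "?m \<le> ?v"
      using m abF by auto
    have "(1 - t) * (?u - ?m) + t * (?v - ?m) \<le> 0"
      using le by (simp add: algebra_simps)
    moreover have "0 \<le> (1 - t) * (?u - ?m)" "0 \<le> t * (?v - ?m)"
      using t uv by auto
    ultimately have "(1 - t) * (?u - ?m) = 0" "t * (?v - ?m) = 0"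
      by linarith+
    then show ?thesis
      using t abF by (simp add: G)
  qed
  have "G \<subseteq> unit_ball (dual K X)"
    using FB by (auto simp: G_def)
  then show "dual_face K X G"
    using closedG by (rule dual_faceI) (rule extremal)
qed

text \<open>
  A minimal face coincides with its set of minimizers of \<open>Re (c * f x)\<close>, for every scalar \<open>c\<close> and every \<open>x\<close>. Hence
  all its elements have the same real and imaginary parts: it is a single point, which is extreme.
\<close>

theorem Krein_Milman_face:
  assumes F: "dual_face K X F" "F \<noteq> {}"
  shows "\<exists>e\<in>F. e \<in> extreme_points (dual K X) (unit_ball (dual K X))"
proof -
  let ?P = "pointwise_topology X" and ?B = "unit_ball (dual K X)"
  define A where "A = {G. dual_face K X G \<and> G \<noteq> {} \<and> G \<subseteq> F}"
  have "\<exists>m\<in>A. \<forall>G\<in>A. G \<subseteq> m \<longrightarrow> G = m"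
  proof (rule predicate_Zorn)
    show "partial_order_on A (relation_of (\<lambda>p q. q \<subseteq> p) A)"
      by (rule partial_order_on_relation_ofI) auto
    fix C assume C: "C \<in> Chains (relation_of (\<lambda>p q. q \<subseteq> p) A)"
    show "\<exists>u\<in>A. \<forall>p\<in>C. u \<subseteq> p"
    proof (cases "C = {}")
      case True
      then show ?thesis
        using F by (intro bexI[of _ F]) (auto simp: A_def)
    next
      case False
      have CA: "C \<subseteq> A"
        using C by (auto simp: Chains_def relation_of_def)
      have chain: "p \<subseteq> q \<or> q \<subseteq> p" if "p \<in> C" "q \<in> C" for p q
        using C that by (auto simp: Chains_def relation_of_def)
      have face: "dual_face K X G" "G \<noteq> {}" "G \<subseteq> F" if "G \<in> C" for G
        using that CA by (auto simp: A_def)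
      \<comment> \<open>A finite part of a chain has a least element, so a chain of nonempty closed sets has the
        finite intersection property.\<close>
      have fin: "\<exists>m\<in>C. m \<subseteq> \<Inter>\<G>" if "finite \<G>" "\<G> \<subseteq> C" for \<G>
        using that
      proof (induction rule: finite_induct)
        case empty
        then show ?case using False by auto
      next
        case (insert G \<G>)
        then have "\<exists>m\<in>C. m \<subseteq> \<Inter>\<G>" by simp
        then obtain m where m: "m \<in> C" "m \<subseteq> \<Inter>\<G>" by (elim bexE)
        have "G \<in> C" using insert.prems by simp
        from chain[OF m(1) this] show ?case
        proof
          assume "m \<subseteq> G"
          then show ?thesis using m by (intro bexI[of _ m]) simp_all
        next
          assume "G \<subseteq> m"
          then have "G \<subseteq> \<Inter>(insert G \<G>)"
            using m(2) by (simp only: Inter_insert le_inf_iff order_refl simp_thms subset_trans)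
          then show ?thesis using \<open>G \<in> C\<close> by (intro bexI[of _ G])
        qed
      qed
      have "?B \<inter> \<Inter>C \<noteq> {}"
      proof (rule Banach_Alaoglu[unfolded compactin_fip, THEN conjunct2, rule_format])
        show "(\<forall>G\<in>C. closedin ?P G) \<and> (\<forall>\<G>. finite \<G> \<and> \<G> \<subseteq> C \<longrightarrow> ?B \<inter> \<Inter>\<G> \<noteq> {})"
        proof (intro conjI ballI allI impI)
          fix \<G> assume "finite \<G> \<and> \<G> \<subseteq> C"
          then have "\<exists>m\<in>C. m \<subseteq> \<Inter>\<G>" by (intro fin) simp_all
          then obtain m where m: "m \<in> C" "m \<subseteq> \<Inter>\<G>" by (elim bexE)
          have "m \<subseteq> ?B"
            using face(1)[OF m(1)] by (simp add: dual_face_def)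
          then have "m \<subseteq> ?B \<inter> \<Inter>\<G>"
            using m(2) by (rule Int_greatest)
          then show "?B \<inter> \<Inter>\<G> \<noteq> {}"
            using face(2)[OF m(1)] by (metis subset_empty)
        qed (use face in \<open>auto simp: dual_face_def\<close>)
      qed
      then have "\<Inter>C \<noteq> {}" by auto
      moreover have "dual_face K X (\<Inter>C)"
      proof (rule dual_faceI)
        show "\<Inter>C \<subseteq> ?B"
          using False face(1) unfolding dual_face_def by blast
        show "closedin ?P (\<Inter>C)"
          using False face(1) unfolding dual_face_def by blast
      next
        fix e a b and t :: real
        assume *: "e \<in> \<Inter>C" "a \<in> ?B" "b \<in> ?B" "0 < t" "t < 1"
          "\<And>x. x \<in> carrier X \<Longrightarrow> e x = of_real (1 - t) * a x + of_real t * b x"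
        have "a \<in> G \<and> b \<in> G" if "G \<in> C" for G
          using dual_faceD[OF face(1)[OF that] _ *(2-6)] *(1) that by auto
        then show "a \<in> \<Inter>C \<and> b \<in> \<Inter>C" by auto
      qed
      moreover have "\<Inter>C \<subseteq> F"
        using False face(3) by auto
      ultimately have "\<Inter>C \<in> A"
        by (simp add: A_def)
      then show ?thesis by (intro bexI[of _ "\<Inter>C"]) auto
    qed
  qed
  then obtain G where GA: "G \<in> A" and min: "\<And>H. H \<in> A \<Longrightarrow> H \<subseteq> G \<Longrightarrow> H = G" by blast
  then have G: "dual_face K X G" "G \<noteq> {}" "G \<subseteq> F" by (auto simp: A_def)
  have le: "Re (c * f x) \<le> Re (c * g x)" if "f \<in> G" "g \<in> G" "x \<in> carrier X" for c f g x
  proof -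
    have "{f \<in> G. \<forall>g\<in>G. Re (c * f x) \<le> Re (c * g x)} = G"
      using dual_face_minimizers[OF G(1,2) that(3), of c] G(3) by (intro min) (auto simp: A_def)
    then show ?thesis using that by blast
  qed
  have GB: "G \<subseteq> ?B" using G(1) by (simp add: dual_face_def)
  have single: "f = g" if fg: "f \<in> G" "g \<in> G" for f g
  proof (rule extensionalityI)
    show "f \<in> extensional (carrier X)" "g \<in> extensional (carrier X)"
      using fg GB functional_extensional[OF unit_ball_carrier] by blast+
    fix x assume x: "x \<in> carrier X"
    show "f x = g x"
      using le[OF fg x, of 1] le[OF fg(2,1) x, of 1] le[OF fg x, of \<i>] le[OF fg(2,1) x, of \<i>]
      by (simp add: complex_eq_iff)
  qed
  obtain e where e: "e \<in> G" using G(2) by blast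
  have "e \<in> extreme_points (dual K X) ?B"
    unfolding extreme_points_def
  proof (intro CollectI conjI ballI allI impI)
    show "e \<in> ?B" using e GB by auto
    fix a b and t :: real
    assume ab: "a \<in> ?B" "b \<in> ?B"
      and "0 < t \<and> t < 1 \<and> e = of_real (1 - t) \<odot>\<^bsub>dual K X\<^esub> a \<oplus>\<^bsub>dual K X\<^esub> of_real t \<odot>\<^bsub>dual K X\<^esub> b"
    then have t: "0 < t" "t < 1"
      and eq: "e = of_real (1 - t) \<odot>\<^bsub>dual K X\<^esub> a \<oplus>\<^bsub>dual K X\<^esub> of_real t \<odot>\<^bsub>dual K X\<^esub> b" by auto
    have "e x = of_real (1 - t) * a x + of_real t * b x" if "x \<in> carrier X" for x
      using that by (subst eq) (simp add: dual_def)
    from dual_faceD[OF G(1) e ab t this] show "a = b"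
      by (rule single)
  qed
  then show ?thesis
    using e G(3) by blast
qed

text \<open>
  The functionals of the dual ball that norm \<open>y\<close> form a face, nonempty by the Hahn--Banach theorem.
\<close>

lemma exists_norming_extreme_point:
  assumes y: "y \<in> carrier X"
  shows "\<exists>e\<in>extreme_points (dual K X) (unit_ball (dual K X)). cmod (e y) = nrm X y"
proof -
  let ?B = "unit_ball (dual K X)"
  define F where "F = {f \<in> ?B. Re (f y) \<in> {nrm X y..}}"
  have le_cmod: "cmod (f y) \<le> nrm X y" if "f \<in> ?B" for f
    using that y by (simp add: dual_unit_ball_iff)
  then have le: "Re (f y) \<le> nrm X y" if "f \<in> ?B" for f
    using that complex_Re_le_cmod order_trans by blast
  obtain g where "g \<in> ?B" "g y = of_real (nrm X y)"
    using Hahn_Banach_norming[OF y] .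
  then have "F \<noteq> {}" by (auto simp: F_def)
  moreover have "dual_face K X F"
  proof (rule dual_faceI)
    show "closedin (pointwise_topology X) F"
      unfolding F_def
      by (intro closedin_preimage closedin_dual_unit_ball continuous_map_evaluation[OF y] continuous_intros)
  next
    fix e a b and t :: real
    assume e: "e \<in> F" and ab: "a \<in> ?B" "b \<in> ?B"
      and t: "0 < t" "t < 1"
      and eq: "\<And>x. x \<in> carrier X \<Longrightarrow> e x = of_real (1 - t) * a x + of_real t * b x"
    let ?N = "nrm X y"
    have "(1 - t) * (?N - Re (a y)) + t * (?N - Re (b y)) \<le> 0"
      using e eq[OF y] by (simp add: F_def algebra_simps)
    moreover have "0 \<le> (1 - t) * (?N - Re (a y))" "0 \<le> t * (?N - Re (b y))"
      using t le ab by auto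
    ultimately have "(1 - t) * (?N - Re (a y)) = 0" "t * (?N - Re (b y)) = 0"
      by linarith+
    then show "a \<in> F \<and> b \<in> F"
      using t ab by (auto simp: F_def)
  qed (auto simp: F_def)
  ultimately obtain e where e: "e \<in> F" "e \<in> extreme_points (dual K X) ?B"
    using Krein_Milman_face by blast
  then have "cmod (e y) = nrm X y"
    using le_cmod[of e] complex_Re_le_cmod[of "e y"] by (auto simp: F_def)
  then show ?thesis using e by blast
qed

lemma nonneg_series_le_iff:
  fixes d :: "nat \<Rightarrow> real"
  assumes "\<And>k. 0 \<le> d k"
  shows "(\<forall>n. sum d {..<n} \<le> c) \<longleftrightarrow> summable d \<and> suminf d \<le> c"
  using assms summableI_nonneg_bounded[of d c] suminf_le_const[of d c] sum_le_suminf[of d]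
  by (meson finite_lessThan order_trans)

text \<open>
  Some \<open>z\<close> in the
  dual ball satisfies \<open>1 - s k \<le> |z (v k)|\<close> for all \<open>k\<close>, by compactness. With \<open>c k\<close> rotating \<open>z (v k)\<close> to the positive half-axis,
  \<open>f \<mapsto> \<Sum>k. 1 - Re (c k * f (v k))\<close> is affine and lower semicontinuous with values in \<open>[0, \<infinity>]\<close>, and finite at \<open>z\<close>. Its minimizers
  form a nonempty face. At an extreme point of this face the series converges, so its terms tend to zero.
\<close>

theorem extreme_point_asymptotically_norming:
  assumes v: "\<And>k. v k \<in> unit_ball X"
    and small: "summable s"
    and finite_norming: "\<And>n. \<exists>f\<in>unit_ball (dual K X). \<forall>k<n. 1 - s k \<le> cmod (f (v k))"
  shows "\<exists>e\<in>extreme_points (dual K X) (unit_ball (dual K X)). (\<lambda>k. cmod (e (v k))) \<longlonglongrightarrow> 1"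
proof -
  let ?P = "pointwise_topology X" and ?B = "unit_ball (dual K X)"
  have vc: "v k \<in> carrier X" for k
    by (rule unit_ball_carrier[OF v])
  have le1: "cmod (f (v k)) \<le> 1" if "f \<in> ?B" for f k
  proof -
    have "cmod (f (v k)) \<le> nrm X (v k)"
      using that vc by (simp add: dual_unit_ball_iff)
    also have "\<dots> \<le> 1"
      using v by (simp add: unit_ball_def)
    finally show ?thesis .
  qed
  obtain z where zB: "z \<in> ?B" and z: "\<And>k. 1 - s k \<le> cmod (z (v k))"
  proof -
    define C where "C n = {f \<in> ?B. \<forall>k\<in>{..<n}. cmod (f (v k)) \<in> {1 - s k..}}" for n
    have "(\<Inter>n. C n) \<noteq> {}"
    proof (rule dual_unit_ball_nest)
      show "closedin ?P (C n)" for n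
        unfolding C_def
        by (intro closedin_Collect_ball closedin_preimage closedin_dual_unit_ball
            continuous_map_evaluation vc continuous_intros)
      show "C n \<noteq> {}" for n
        using finite_norming[of n] by (auto simp: C_def)
    qed (auto simp: C_def decseq_def)
    then obtain z where "z \<in> C n" for n by blast
    then show thesis
      by (intro that[of z]) (auto simp: C_def)
  qed
  define c where "c k = cnj (sgn (z (v k)))" for k
  define d where "d f k = 1 - Re (c k * f (v k))" for f k
  have c1: "cmod (c k) \<le> 1" for k
    by (simp add: c_def norm_sgn)
  have Re_le: "Re (c k * f (v k)) \<le> cmod (f (v k))" if "f \<in> ?B" for f k
    using complex_Re_le_cmod[of "c k * f (v k)"] c1[of k] mult_right_mono[of "cmod (c k)" 1 "cmod (f (v k))"]
    by (simp add: norm_mult)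
  have d_nonneg: "0 \<le> d f k" if "f \<in> ?B" for f k
    using Re_le[OF that, of k] le1[OF that, of k] by (simp add: d_def)
  have series: "(\<forall>n. sum (d f) {..<n} \<le> r) \<longleftrightarrow> summable (d f) \<and> suminf (d f) \<le> r" if "f \<in> ?B" for f r
    by (rule nonneg_series_le_iff) (rule d_nonneg[OF that])
  have "d z k = 1 - cmod (z (v k))" for k
    by (simp add: d_def c_def cnj_sgn_mult)
  then have "d z k \<le> s k" for k
    using z[of k] by simp
  then have sum_z: "summable (d z)"
    using d_nonneg[OF zB] by (intro summable_comparison_test'[OF small, of 0]) auto
  \<comment> \<open>On \<open>S\<close> the series is finite; \<open>m\<close> is its minimal value. Bounding all partial sums by \<open>m\<close>
    exhibits the set \<open>F\<close> of minimizers as closed.\<close>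
  define S where "S = {f \<in> ?B. summable (d f)}"
  define m where "m = Inf ((\<lambda>f. suminf (d f)) ` S)"
  have m_le: "m \<le> suminf (d f)" if "f \<in> S" for f
    unfolding m_def
  proof (rule cINF_lower[OF _ that])
    show "bdd_below ((\<lambda>f. suminf (d f)) ` S)"
      by (intro bdd_belowI2[of _ 0] suminf_nonneg) (auto simp: S_def d_nonneg)
  qed
  define F where "F = {f \<in> ?B. \<forall>n\<in>UNIV. sum (d f) {..<n} \<in> {..m}}"
  have closed: "closedin ?P {f \<in> ?B. \<forall>n\<in>UNIV. sum (d f) {..<n} \<in> {..r}}" for r
    unfolding d_def
    by (intro closedin_Collect_ball closedin_preimage closedin_dual_unit_ball continuous_map_sum
        continuous_map_evaluation vc continuous_intros) auto
  have F_iff: "f \<in> F \<longleftrightarrow> f \<in> S \<and> suminf (d f) \<le> m" for f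
    using series[of f m] by (auto simp: F_def S_def)
  have "dual_face K X F"
  proof (rule dual_faceI)
    show "closedin ?P F"
      unfolding F_def by (rule closed)
  next
    fix e a b and t :: real
    assume e: "e \<in> F" and ab: "a \<in> ?B" "b \<in> ?B"
      and t: "0 < t" "t < 1"
      and eq: "\<And>x. x \<in> carrier X \<Longrightarrow> e x = of_real (1 - t) * a x + of_real t * b x"
    have de: "d e k = (1 - t) * d a k + t * d b k" for k
      unfolding d_def eq[OF vc] by (simp add: algebra_simps)
    have se: "summable (d e)" "suminf (d e) \<le> m"
      using e by (auto simp: F_iff S_def)
    have "summable (\<lambda>k. (1 - t) * d a k)" "summable (\<lambda>k. t * d b k)"
      by (rule summable_comparison_test'[OF se(1), of 0];
          use t d_nonneg[OF ab(1)] d_nonneg[OF ab(2)] in \<open>simp add: de\<close>)+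
    then have sab: "summable (d a)" "summable (d b)"
      using t by (auto simp: summable_cmult_iff)
    then have "suminf (d e) = (1 - t) * suminf (d a) + t * suminf (d b)"
      unfolding de by (subst suminf_add[symmetric]) (auto simp: suminf_mult summable_mult)
    then have le: "(1 - t) * (suminf (d a) - m) + t * (suminf (d b) - m) \<le> 0"
      using se(2) by (simp add: algebra_simps)
    have S: "a \<in> S" "b \<in> S"
      using sab ab by (auto simp: S_def)
    have "0 \<le> (1 - t) * (suminf (d a) - m)" "0 \<le> t * (suminf (d b) - m)"
      using t m_le[OF S(1)] m_le[OF S(2)] by auto
    then have "(1 - t) * (suminf (d a) - m) = 0" "t * (suminf (d b) - m) = 0"
      using le by linarith+
    then show "a \<in> F \<and> b \<in> F"
      using t S by (auto simp: F_iff)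
  qed (auto simp: F_def)
  moreover have "F \<noteq> {}"
  proof -
    \<comment> \<open>The minimum is attained: the sublevel sets above \<open>m\<close> are nonempty, closed and nested.\<close>
    define E where "E n = {f \<in> ?B. \<forall>k\<in>UNIV. sum (d f) {..<k} \<in> {..m + inverse (real (Suc n))}}" for n
    have "(\<Inter>n. E n) \<noteq> {}"
    proof (rule dual_unit_ball_nest)
      show "closedin ?P (E n)" for n
        unfolding E_def by (rule closed)
      show "E n \<noteq> {}" for n
      proof -
        have "\<exists>f\<in>S. suminf (d f) < m + inverse (real (Suc n))"
          using cInf_lessD[of "(\<lambda>f. suminf (d f)) ` S" "m + inverse (real (Suc n))"] zB sum_z
          unfolding m_def by (auto simp: S_def)
        then show ?thesis
          using series by (force simp: E_def S_def)
      qed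
      show "decseq E"
      proof (rule antimonoI)
        fix i j :: nat assume "i \<le> j"
        then have "inverse (real (Suc j)) \<le> inverse (real (Suc i))"
          by (intro le_imp_inverse_le) auto
        then have "r \<le> m + inverse (real (Suc i))" if "r \<le> m + inverse (real (Suc j))" for r
          using that by linarith
        then show "E j \<subseteq> E i"
          unfolding E_def by blast
      qed
    qed (auto simp: E_def)
    then obtain f where f: "f \<in> E n" for n by blast
    have "sum (d f) {..<k} \<le> m" for k
    proof (rule LIMSEQ_le_const)
      show "(\<lambda>n. m + inverse (real (Suc n))) \<longlonglongrightarrow> m"
        using LIMSEQ_inverse_real_of_nat_add by simp
      show "\<exists>N. \<forall>n\<ge>N. sum (d f) {..<k} \<le> m + inverse (real (Suc n))"
        using f by (auto simp: E_def)
    qed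
    then have "f \<in> F"
      using f[of 0] by (auto simp: F_def E_def)
    then show ?thesis by blast
  qed
  ultimately obtain e where e: "e \<in> F" "e \<in> extreme_points (dual K X) ?B"
    using Krein_Milman_face by blast
  have eB: "e \<in> ?B" using e by (simp add: F_def)
  have "d e \<longlonglongrightarrow> 0"
    using e by (intro summable_LIMSEQ_zero) (simp add: F_iff S_def)
  then have lower: "(\<lambda>k. 1 - d e k) \<longlonglongrightarrow> 1"
    using tendsto_diff[of "\<lambda>_. 1" 1 sequentially "d e" 0] by simp
  have "(\<lambda>k. cmod (e (v k))) \<longlonglongrightarrow> 1"
  proof (rule tendsto_sandwich[OF always_eventually always_eventually lower tendsto_const])
    show "\<forall>k. 1 - d e k \<le> cmod (e (v k))"
      using Re_le[OF eB] by (simp add: d_def)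
  qed (simp add: le1[OF eB])
  then show ?thesis using e by blast
qed

end

section \<open>Rank one perturbations\<close>

lemma (in normed_space) nrm_le_pairing:
  assumes "y \<in> carrier X" "\<And>f. f \<in> unit_ball (dual K X) \<Longrightarrow> cmod (f y) \<le> c"
  shows "nrm X y \<le> c"
proof -
  obtain f where "f \<in> unit_ball (dual K X)" "f y = of_real (nrm X y)"
    using Hahn_Banach_norming[OF assms(1)] .
  then show ?thesis
    using assms(2)[of f] nrm_nonneg[OF assms(1)] by simp
qed

definition rank_one_update ::
  "'a nmodule \<Rightarrow> 'b nmodule \<Rightarrow> ('a \<Rightarrow> 'b) \<Rightarrow> ('a \<Rightarrow> complex) \<Rightarrow> 'b \<Rightarrow> 'a \<Rightarrow> 'b" where
  "rank_one_update X Y T g v = (\<lambda>x\<in>carrier X. T x \<oplus>\<^bsub>Y\<^esub> g x \<odot>\<^bsub>Y\<^esub> v)"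

context normed_space_pair
begin

lemma rank_one_finite_rank:
  assumes g: "g \<in> carrier (dual K X)" and v: "v \<in> carrier Y"
  shows "(\<lambda>x\<in>carrier X. g x \<odot>\<^bsub>Y\<^esub> v) \<in> finite_rank_operators K X Y"
  unfolding finite_rank_operators_def
proof (intro CollectI conjI exI[of _ "{v}"] ballI)
  note gK = dom.functional_closed[OF g]
  show "(\<lambda>x\<in>carrier X. g x \<odot>\<^bsub>Y\<^esub> v) \<in> bounded_operators K X Y"
  proof (rule bounded_operatorI[where C = "nrm (dual K X) g * nrm Y v"])
    fix x assume x: "x \<in> carrier X"
    show "nrm Y ((\<lambda>x\<in>carrier X. g x \<odot>\<^bsub>Y\<^esub> v) x) \<le> nrm (dual K X) g * nrm Y v * nrm X x"
      using mult_right_mono[OF dom.functional_bound[OF g x] cod.nrm_nonneg[OF v]] x v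
      by (simp add: gK cod.nrm_smult mult_ac)
  qed (simp_all add: gK v dom.functional_add[OF g] dom.functional_smult[OF g]
    cod.smult_add_left cod.smult_smult)
  fix x assume x: "x \<in> carrier X"
  have "(\<lambda>x\<in>carrier X. g x \<odot>\<^bsub>Y\<^esub> v) x = (\<Oplus>\<^bsub>Y\<^esub>b\<in>{v}. g x \<odot>\<^bsub>Y\<^esub> b)"
    using cod.M.finsum_insert[of "{}" v "\<lambda>b. g x \<odot>\<^bsub>Y\<^esub> b"] x v gK[OF x] by simp
  then show "\<exists>c\<in>{v} \<rightarrow> K. (\<lambda>x\<in>carrier X. g x \<odot>\<^bsub>Y\<^esub> v) x = (\<Oplus>\<^bsub>Y\<^esub>b\<in>{v}. c b \<odot>\<^bsub>Y\<^esub> b)"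
    using gK[OF x] by (intro bexI[of _ "\<lambda>_. g x"]) auto
qed (use v in auto)

lemma rank_one_update_eq:
  "rank_one_update X Y T g v = T \<oplus>\<^bsub>operator_space K X Y\<^esub> (\<lambda>x\<in>carrier X. g x \<odot>\<^bsub>Y\<^esub> v)"
  by (auto simp: rank_one_update_def)

lemma rank_one_update_bounded:
  assumes "T \<in> bounded_operators K X Y" "g \<in> carrier (dual K X)" "v \<in> carrier Y"
  shows "rank_one_update X Y T g v \<in> bounded_operators K X Y"
  unfolding rank_one_update_eq using rank_one_finite_rank[OF assms(2,3)] assms(1)
  by (intro operator_space_add_closed) (auto simp: finite_rank_operators_def)

lemma functional_rank_one_update:
  assumes "T \<in> bounded_operators K X Y" "g \<in> carrier (dual K X)" "v \<in> carrier Y"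
    and f: "f \<in> carrier (dual K Y)" and "x \<in> carrier X"
  shows "f (rank_one_update X Y T g v x) = f (T x) + g x * f v"
  using assms operator_closed[OF assms(1)] dom.functional_closed[OF assms(2)]
  by (simp add: rank_one_update_def cod.functional_add[OF f] cod.functional_smult[OF f])

lemma pullback_functional:
  assumes T: "T \<in> bounded_operators K X Y" and f: "f \<in> carrier (dual K Y)"
  shows "(\<lambda>x\<in>carrier X. f (T x)) \<in> carrier (dual K X)"
proof (rule dom.functionalI[where C = "nrm (dual K Y) f * operator_norm X Y T"])
  interpret dual: normed_space K "dual K Y" by (rule cod.normed_space_dual)
  fix x assume x: "x \<in> carrier X"
  have "cmod (f (T x)) \<le> nrm (dual K Y) f * nrm Y (T x)"
    by (rule cod.functional_bound[OF f operator_closed[OF T x]])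
  also have "\<dots> \<le> nrm (dual K Y) f * (operator_norm X Y T * nrm X x)"
    by (intro mult_left_mono operator_norm_bound[OF T x] dual.nrm_nonneg[OF f])
  finally show "cmod ((\<lambda>x\<in>carrier X. f (T x)) x) \<le> nrm (dual K Y) f * operator_norm X Y T * nrm X x"
    using x by (simp add: mult.assoc)
qed (simp_all add: operator_closed[OF T] operator_add[OF T] operator_smult[OF T]
  cod.functional_closed[OF f] cod.functional_add[OF f] cod.functional_smult[OF f])

lemma pairing_le_operator_norm:
  assumes T: "T \<in> bounded_operators K X Y" and x: "x \<in> unit_ball X" and f: "f \<in> unit_ball (dual K Y)"
  shows "cmod (f (T x)) \<le> operator_norm X Y T"
  using f operator_closed[OF T unit_ball_carrier[OF x]] operator_norm_ball[OF T x]
  by (force simp: cod.dual_unit_ball_iff)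

lemma operator_norm_le_pairing:
  assumes T: "T \<in> bounded_operators K X Y"
    and "\<And>x f. x \<in> unit_ball X \<Longrightarrow> f \<in> unit_ball (dual K Y) \<Longrightarrow> cmod (f (T x)) \<le> c"
  shows "operator_norm X Y T \<le> c"
  by (intro operator_norm_le cod.nrm_le_pairing operator_closed[OF T] unit_ball_carrier assms(2))

lemma operator_norm_diff_le:
  assumes S: "S \<in> bounded_operators K X Y" and T: "T \<in> bounded_operators K X Y"
    and "\<And>x f. x \<in> unit_ball X \<Longrightarrow> f \<in> unit_ball (dual K Y) \<Longrightarrow> cmod (f (S x) - f (T x)) \<le> d"
  shows "operator_norm X Y S \<le> operator_norm X Y T + d"
proof (rule operator_norm_le_pairing[OF S])
  fix x f assume x: "x \<in> unit_ball X" and f: "f \<in> unit_ball (dual K Y)"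
  show "cmod (f (S x)) \<le> operator_norm X Y T + d"
    using assms(3)[OF x f] pairing_le_operator_norm[OF T x f] norm_triangle_sub[of "f (S x)" "f (T x)"]
    by simp
qed

lemma nrm_operator_space_diff_le:
  assumes S: "S \<in> bounded_operators K X Y" and T: "T \<in> bounded_operators K X Y"
    and "\<And>x f. x \<in> unit_ball X \<Longrightarrow> f \<in> unit_ball (dual K Y) \<Longrightarrow> cmod (f (S x) - f (T x)) \<le> d"
  shows "nrm (operator_space K X Y) (S \<ominus>\<^bsub>operator_space K X Y\<^esub> T) \<le> d"
proof -
  interpret L: normed_space K "operator_space K X Y"
    by (rule normed_space_operator_space)
  have "S \<ominus>\<^bsub>operator_space K X Y\<^esub> T \<in> bounded_operators K X Y"
    using L.M.minus_closed[of S T] S T by simp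
  then show ?thesis
    unfolding operator_space_simps(5)
  proof (rule operator_norm_le_pairing)
    fix x f assume x: "x \<in> unit_ball X" and f: "f \<in> unit_ball (dual K Y)"
    note xc = unit_ball_carrier[OF x]
    show "cmod (f ((S \<ominus>\<^bsub>operator_space K X Y\<^esub> T) x)) \<le> d"
      using assms(3)[OF x f] operator_closed[OF S xc] operator_closed[OF T xc]
      by (simp add: operator_space_diff[OF S T xc] cod.functional_diff[OF unit_ball_carrier[OF f]])
  qed
qed

text \<open>
  Choose \<open>x\<close> nearly norming for \<open>S\<close>, let \<open>v\<close> be the direction of \<open>S x\<close> and \<open>g = e h\<close>, where \<open>h\<close> norms \<open>x\<close>. Then the perturbed
  operator maps \<open>x\<close> to \<open>(\<parallel>S x\<parallel> + e) v\<close>, so its norm grows by almost \<open>e\<close>, while a functional \<open>f\<close> notices the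
  perturbation only to the extent of \<open>e |f v|\<close>.
\<close>

lemma norm_increasing_update:
  assumes S: "S \<in> bounded_operators K X Y" and "0 \<le> e" "0 < s"
    and "carrier X \<noteq> {\<zero>\<^bsub>X\<^esub>}" "carrier Y \<noteq> {\<zero>\<^bsub>Y\<^esub>}"
  obtains g v x where "g \<in> carrier (dual K X)" "v \<in> unit_sphere Y" "x \<in> unit_ball X"
    "S x = of_real (nrm Y (S x)) \<odot>\<^bsub>Y\<^esub> v" "operator_norm X Y S - s < nrm Y (S x)"
    "operator_norm X Y S - s + e \<le> operator_norm X Y (rank_one_update X Y S g v)"
    "\<And>z f. z \<in> unit_ball X \<Longrightarrow> f \<in> unit_ball (dual K Y) \<Longrightarrow>
      cmod (f (rank_one_update X Y S g v z) - f (S z)) \<le> e * cmod (f v)"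
proof -
  obtain x where x: "x \<in> unit_sphere X" and near: "operator_norm X Y S - s < nrm Y (S x)"
    using operator_norm_approx_sphere[OF S _ assms(4), of "operator_norm X Y S - s"] assms(3) by auto
  have xc: "x \<in> carrier X" and x1: "nrm X x = 1" and xB: "x \<in> unit_ball X"
    using x by (auto simp: unit_sphere_def unit_ball_def)
  note Sx = operator_closed[OF S xc]
  obtain v where v: "v \<in> unit_sphere Y" and Sxv: "S x = of_real (nrm Y (S x)) \<odot>\<^bsub>Y\<^esub> v"
  proof (cases "S x = \<zero>\<^bsub>Y\<^esub>")
    case True
    obtain y where y: "y \<in> carrier Y" "y \<noteq> \<zero>\<^bsub>Y\<^esub>"
      using assms(5) cod.M.zero_closed by blast
    define u where "u = of_real (inverse (nrm Y y)) \<odot>\<^bsub>Y\<^esub> y"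
    have u: "u \<in> unit_sphere Y"
      unfolding u_def by (rule cod.normalize(1)[OF y])
    then have "u \<in> carrier Y"
      by (simp add: unit_sphere_def)
    then show thesis
      by (intro that[OF u]) (simp add: True)
  next
    case False
    show thesis
      using that cod.normalize[OF Sx False] by metis
  qed
  have vc: "v \<in> carrier Y" and v1: "nrm Y v = 1"
    using v by (auto simp: unit_sphere_def)
  obtain h where h: "h \<in> unit_ball (dual K X)" "h x = 1"
    using dom.Hahn_Banach_norming[OF xc] x1 by (metis of_real_1)
  interpret DX: normed_space K "dual K X" by (rule dom.normed_space_dual)
  define g where "g = of_real e \<odot>\<^bsub>dual K X\<^esub> h"
  have g: "g \<in> carrier (dual K X)"
    using unit_ball_carrier[OF h(1)] by (simp add: g_def)
  have g_eq: "g z = of_real e * h z" if "z \<in> carrier X" for z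
    using that by (simp add: g_def dual_def)
  note update = functional_rank_one_update[OF S g vc unit_ball_carrier]
  note Ub = rank_one_update_bounded[OF S g vc]
  show thesis
  proof (rule that[OF g v xB Sxv near])
    obtain f where f: "f \<in> unit_ball (dual K Y)" "f v = 1"
      using cod.Hahn_Banach_norming[OF vc] v1 by (metis of_real_1)
    have "f (S x) = of_real (nrm Y (S x))"
      by (subst Sxv) (simp add: cod.functional_smult[OF unit_ball_carrier[OF f(1)]] vc f(2))
    then have "f (rank_one_update X Y S g v x) = of_real (nrm Y (S x) + e)"
      by (simp add: update[OF f(1) xc] g_eq[OF xc] h(2) f(2))
    then have "cmod (f (rank_one_update X Y S g v x)) = nrm Y (S x) + e"
      using cod.nrm_nonneg[OF Sx] \<open>0 \<le> e\<close> by (simp only: norm_of_real)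
    then show "operator_norm X Y S - s + e \<le> operator_norm X Y (rank_one_update X Y S g v)"
      using pairing_le_operator_norm[OF Ub xB f(1)] near by simp
  next
    fix z f assume z: "z \<in> unit_ball X" and f: "f \<in> unit_ball (dual K Y)"
    note zc = unit_ball_carrier[OF z]
    have "cmod (h z) \<le> nrm X z"
      using h(1) zc by (simp add: dom.dual_unit_ball_iff)
    then have "cmod (h z) \<le> 1"
      using z by (simp add: unit_ball_def)
    then have "e * cmod (h z) * cmod (f v) \<le> e * 1 * cmod (f v)"
      using \<open>0 \<le> e\<close> by (intro mult_right_mono mult_left_mono) auto
    then show "cmod (f (rank_one_update X Y S g v z) - f (S z)) \<le> e * cmod (f v)"
      using \<open>0 \<le> e\<close> by (simp add: update[OF f zc] g_eq[OF zc] norm_mult)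
  qed
qed

text \<open>
  Iterating the preceding lemma with weights \<open>w k\<close> yields operators \<open>U k\<close> and directions \<open>v k\<close>. A functional \<open>f\<close> that
  nearly norms \<open>U j\<close>, where \<open>k < j\<close>, nearly norms \<open>U (Suc k)\<close>, since the later weights are tiny compared with \<open>w k\<close>. But the norm
  of \<open>U (Suc k)\<close> exceeds that of \<open>U k\<close> by almost \<open>w k\<close>, and \<open>f\<close> can profit from the perturbation only by \<open>w k |f (v k)|\<close>.
  Therefore \<open>|f (v k)|\<close> is almost 1, with an error that is summable over \<open>k\<close> and independent of \<open>j\<close>. An extreme
  point \<open>e\<close> with \<open>|e (v k)| \<rightarrow> 1\<close> then nearly norms the values of \<open>U k\<close> in the direction \<open>v k\<close>, which nearly norm \<open>U k\<close>.

  The set \<open>A\<close> stands for the component of an operator ideal. Note that \<open>e\<close> is chosen before \<open>\<kappa>\<close>.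
\<close>

theorem adjoint_nearly_norming_extreme_point:
  assumes A: "A \<subseteq> bounded_operators K X Y"
    and closed: "\<And>S g v. S \<in> A \<Longrightarrow> g \<in> carrier (dual K X) \<Longrightarrow> v \<in> carrier Y \<Longrightarrow>
      rank_one_update X Y S g v \<in> A"
    and T: "T \<in> A" and "0 < \<epsilon>"
    and nonzero: "carrier X \<noteq> {\<zero>\<^bsub>X\<^esub>}" "carrier Y \<noteq> {\<zero>\<^bsub>Y\<^esub>}"
  obtains e where "e \<in> extreme_points (dual K Y) (unit_ball (dual K Y))"
    "\<forall>\<kappa>>0. \<exists>S\<in>A. \<exists>x\<in>unit_ball X. operator_norm X Y S - \<kappa> < cmod (e (S x)) \<and>
      (\<forall>z\<in>unit_ball X. \<forall>f\<in>unit_ball (dual K Y). cmod (f (S z) - f (T z)) \<le> \<epsilon>)"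
proof -
  let ?BX = "unit_ball X" and ?BY = "unit_ball (dual K Y)" and ?N = "operator_norm X Y"
  \<comment> \<open>The ratio of consecutive weights leaves room for the five errors of size at most \<open>w (Suc k)\<close> that
    occur below, and makes \<open>5 * w (Suc k) / w k\<close> at most \<open>(1/2) ^ k\<close>.\<close>
  define w where "w = rec_nat (\<epsilon> / 2) (\<lambda>k r. r * (1/2) ^ k / 12)"
  have w0: "w 0 = \<epsilon> / 2" and wS: "w (Suc k) = w k * (1/2) ^ k / 12" for k
    by (simp_all add: w_def)
  have w_pos: "0 < w k" for k
    by (induction k) (simp_all add: w0 wS \<open>0 < \<epsilon>\<close>)
  have w_half: "2 * w (Suc k) \<le> w k" for k
    using w_pos[of k] mult_left_mono[of "(1/2) ^ k" 1 "w k"] power_le_one[of "1/2::real" k]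
    by (simp add: wS)
  have "\<exists>U. \<forall>n. (U n \<in> A \<and> (n = 0 \<longrightarrow> U n = T)) \<and>
    (\<exists>v\<in>unit_sphere Y. (\<exists>x\<in>?BX. U n x = of_real (nrm Y (U n x)) \<odot>\<^bsub>Y\<^esub> v \<and>
        ?N (U n) - w (Suc n) < nrm Y (U n x)) \<and>
      ?N (U n) - w (Suc n) + w n \<le> ?N (U (Suc n)) \<and>
      (\<forall>z\<in>?BX. \<forall>f\<in>?BY. cmod (f (U (Suc n) z) - f (U n z)) \<le> w n * cmod (f v)))"
  proof (rule dependent_nat_choice)
    show "\<exists>S. S \<in> A \<and> (0 = (0::nat) \<longrightarrow> S = T)"
      using T by blast
    fix S and n :: nat assume "S \<in> A \<and> (n = 0 \<longrightarrow> S = T)"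
    then have S: "S \<in> A" by simp
    then have Sb: "S \<in> bounded_operators K X Y" using A by auto
    obtain g v x where g: "g \<in> carrier (dual K X)" and v: "v \<in> unit_sphere Y"
      and x: "x \<in> ?BX" "S x = of_real (nrm Y (S x)) \<odot>\<^bsub>Y\<^esub> v" "?N S - w (Suc n) < nrm Y (S x)"
      and N: "?N S - w (Suc n) + w n \<le> ?N (rank_one_update X Y S g v)"
      and near: "\<And>z f. z \<in> ?BX \<Longrightarrow> f \<in> ?BY \<Longrightarrow>
        cmod (f (rank_one_update X Y S g v z) - f (S z)) \<le> w n * cmod (f v)"
      using norm_increasing_update[OF Sb less_imp_le[OF w_pos] w_pos nonzero] by metis
    have "rank_one_update X Y S g v \<in> A"
      using closed[OF S g] v by (simp add: unit_sphere_def)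
    then show "\<exists>S'. (S' \<in> A \<and> (Suc n = 0 \<longrightarrow> S' = T)) \<and>
      (\<exists>v\<in>unit_sphere Y. (\<exists>x\<in>?BX. S x = of_real (nrm Y (S x)) \<odot>\<^bsub>Y\<^esub> v \<and>
          ?N S - w (Suc n) < nrm Y (S x)) \<and>
        ?N S - w (Suc n) + w n \<le> ?N S' \<and>
        (\<forall>z\<in>?BX. \<forall>f\<in>?BY. cmod (f (S' z) - f (S z)) \<le> w n * cmod (f v)))"
      using v x N near by blast
  qed
  then obtain U where UA: "\<And>n. U n \<in> A" and U0: "U 0 = T" and
    ex: "\<And>n. \<exists>v\<in>unit_sphere Y. (\<exists>x\<in>?BX. U n x = of_real (nrm Y (U n x)) \<odot>\<^bsub>Y\<^esub> v \<and>
        ?N (U n) - w (Suc n) < nrm Y (U n x)) \<and>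
      ?N (U n) - w (Suc n) + w n \<le> ?N (U (Suc n)) \<and>
      (\<forall>z\<in>?BX. \<forall>f\<in>?BY. cmod (f (U (Suc n) z) - f (U n z)) \<le> w n * cmod (f v))"
    by blast
  have "\<forall>n. \<exists>v. v \<in> unit_sphere Y \<and> (\<exists>x\<in>?BX. U n x = of_real (nrm Y (U n x)) \<odot>\<^bsub>Y\<^esub> v \<and>
        ?N (U n) - w (Suc n) < nrm Y (U n x)) \<and>
      ?N (U n) - w (Suc n) + w n \<le> ?N (U (Suc n)) \<and>
      (\<forall>z\<in>?BX. \<forall>f\<in>?BY. cmod (f (U (Suc n) z) - f (U n z)) \<le> w n * cmod (f v))"
    using ex by blast
  then obtain v where v: "\<And>n. v n \<in> unit_sphere Y"
    and near_max: "\<And>n. \<exists>x\<in>?BX. U n x = of_real (nrm Y (U n x)) \<odot>\<^bsub>Y\<^esub> v n \<and>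
      ?N (U n) - w (Suc n) < nrm Y (U n x)"
    and growth: "\<And>n. ?N (U n) - w (Suc n) + w n \<le> ?N (U (Suc n))"
    and move: "\<And>n z f. z \<in> ?BX \<Longrightarrow> f \<in> ?BY \<Longrightarrow>
      cmod (f (U (Suc n) z) - f (U n z)) \<le> w n * cmod (f (v n))"
    by metis
  have Ub: "U n \<in> bounded_operators K X Y" for n
    using UA A by auto
  have v1: "cmod (f (v n)) \<le> 1" if "f \<in> ?BY" for f n
    using that v[of n] by (force simp: cod.dual_unit_ball_iff unit_sphere_def)
  \<comment> \<open>The weights at least halve in every step, so their tail from \<open>k\<close> on is at most \<open>2 * w k\<close>;
    the subtracted term makes the induction work.\<close>
  have dist: "cmod (f (U j z) - f (U k z)) \<le> 2 * (w k - w j)"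
    if "k \<le> j" "z \<in> ?BX" "f \<in> ?BY" for j k z f
    using that(1)
  proof (induction rule: dec_induct)
    case (step j)
    have "cmod (f (U (Suc j) z) - f (U j z)) \<le> w j"
      using order_trans[OF move[OF that(2,3)] mult_left_le[OF v1[OF that(3)] less_imp_le[OF w_pos]]] .
    then have "cmod (f (U (Suc j) z) - f (U k z)) \<le> w j + 2 * (w k - w j)"
      using step.IH norm_triangle_ineq[of "f (U (Suc j) z) - f (U j z)" "f (U j z) - f (U k z)"] by simp
    then show ?case
      using w_half[of j] by simp
  qed simp
  have "\<exists>e\<in>extreme_points (dual K Y) ?BY. (\<lambda>k. cmod (e (v k))) \<longlonglongrightarrow> 1"
  proof (rule cod.extreme_point_asymptotically_norming)
    show "v k \<in> unit_ball Y" for k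
      by (rule unit_sphere_ball[OF v])
    show "summable (\<lambda>k. (1/2::real) ^ k)"
      by (simp add: summable_geometric)
    fix j
    obtain z where z: "z \<in> ?BX" "?N (U j) - w j < nrm Y (U j z)"
      using operator_norm_approx[OF Ub, of "?N (U j) - w j" j] w_pos[of j] by auto
    obtain f where f: "f \<in> ?BY" "f (U j z) = of_real (nrm Y (U j z))"
      using cod.Hahn_Banach_norming[OF operator_closed[OF Ub unit_ball_carrier[OF z(1)]]] .
    have fj: "cmod (f (U j z)) = nrm Y (U j z)"
      using f(2) cod.nrm_nonneg[OF operator_closed[OF Ub unit_ball_carrier[OF z(1)]]] by simp
    have "1 - (1/2) ^ k \<le> cmod (f (v k))" if "k < j" for k
    proof -
      have k: "Suc k \<le> j" using that by simp
      have 1: "cmod (f (U j z) - f (U (Suc k) z)) \<le> 2 * (w (Suc k) - w j)"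
        by (rule dist[OF k z(1) f(1)])
      have 2: "?N (U (Suc k)) \<le> ?N (U j) + 2 * (w (Suc k) - w j)"
        by (rule operator_norm_diff_le[OF Ub Ub]) (subst norm_minus_commute, rule dist[OF k])
      have 3: "cmod (f (U (Suc k) z) - f (U k z)) \<le> w k * cmod (f (v k))"
        by (rule move[OF z(1) f(1)])
      have 4: "cmod (f (U k z)) \<le> ?N (U k)"
        by (rule pairing_le_operator_norm[OF Ub z(1) f(1)])
      have "cmod (f (U j z)) \<le> cmod (f (U j z) - f (U (Suc k) z)) +
          cmod (f (U (Suc k) z) - f (U k z)) + cmod (f (U k z))"
        using norm_triangle_ineq[of "f (U j z) - f (U (Suc k) z)" "f (U (Suc k) z) - f (U k z) + f (U k z)"]
          norm_triangle_ineq[of "f (U (Suc k) z) - f (U k z)" "f (U k z)"] by simp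
      then have "nrm Y (U j z) \<le> 2 * (w (Suc k) - w j) + w k * cmod (f (v k)) + ?N (U k)"
        using 1 3 4 fj by linarith
      moreover have "?N (U k) + w k - 3 * w (Suc k) + w j \<le> nrm Y (U j z)"
        using 2 growth[of k] z(2) by (simp add: algebra_simps)
      ultimately have "w k - 5 * w (Suc k) \<le> w k * cmod (f (v k))"
        using w_pos[of j] by (simp add: algebra_simps)
      moreover have "5 * w (Suc k) \<le> w k * (1/2) ^ k"
        using w_pos[of k] by (simp add: wS)
      ultimately have "w k * (1 - (1/2) ^ k) \<le> w k * cmod (f (v k))"
        by (simp add: algebra_simps)
      then show ?thesis
        using w_pos[of k] by (simp only: mult_le_cancel_left_pos)
    qed
    then show "\<exists>f\<in>?BY. \<forall>k<j. 1 - (1/2) ^ k \<le> cmod (f (v k))"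
      using f(1) by blast
  qed
  then obtain e where e: "e \<in> extreme_points (dual K Y) ?BY" and lim: "(\<lambda>k. cmod (e (v k))) \<longlonglongrightarrow> 1"
    by blast
  have eB: "e \<in> ?BY" using e by (simp add: extreme_points_def)
  have "w k \<le> \<epsilon> / 2 * (1/2) ^ k" for k
  proof (induction k)
    case (Suc k)
    then show ?case using w_half[of k] by simp
  qed (simp add: w0)
  moreover have "(\<lambda>k. \<epsilon> / 2 * (1/2) ^ k) \<longlonglongrightarrow> 0"
    by (intro tendsto_mult_right_zero LIMSEQ_power_zero) simp
  ultimately have "w \<longlonglongrightarrow> 0"
    using w_pos by (intro tendsto_sandwich[of "\<lambda>_. 0" w _ "\<lambda>k. \<epsilon> / 2 * (1/2) ^ k"]) (auto simp: less_imp_le)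
  then have w_lim: "(\<lambda>k. w (Suc k)) \<longlonglongrightarrow> 0"
    by (rule LIMSEQ_Suc)
  have close: "cmod (f (U k z) - f (T z)) \<le> \<epsilon>" if "z \<in> ?BX" "f \<in> ?BY" for k z f
    using dist[of 0 k z f] that w_pos[of k] by (simp add: U0 w0)
  show thesis
  proof (rule that[OF e], intro allI impI)
    fix \<kappa> :: real assume "0 < \<kappa>"
    let ?M = "?N T + \<epsilon>"
    have "(\<lambda>k. w (Suc k) + ?M * (1 - cmod (e (v k)))) \<longlonglongrightarrow> 0 + ?M * (1 - 1)"
      by (intro tendsto_intros w_lim lim)
    then have "eventually (\<lambda>k. w (Suc k) + ?M * (1 - cmod (e (v k))) < \<kappa>) sequentially"
      using \<open>0 < \<kappa>\<close> by (intro order_tendstoD(2)) simp_all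
    then obtain k where k: "w (Suc k) + ?M * (1 - cmod (e (v k))) < \<kappa>"
      using eventually_happens' sequentially_bot by blast
    obtain x where x: "x \<in> ?BX" "U k x = of_real (nrm Y (U k x)) \<odot>\<^bsub>Y\<^esub> v k"
      "?N (U k) - w (Suc k) < nrm Y (U k x)"
      using near_max by blast
    have vc: "v k \<in> carrier Y"
      using v[of k] by (simp add: unit_sphere_def)
    have n0: "0 \<le> nrm Y (U k x)"
      by (rule cod.nrm_nonneg[OF operator_closed[OF Ub unit_ball_carrier[OF x(1)]]])
    have "e (U k x) = of_real (nrm Y (U k x)) * e (v k)"
      by (subst x(2)) (simp add: cod.functional_smult[OF unit_ball_carrier[OF eB]] vc)
    then have eq: "cmod (e (U k x)) = nrm Y (U k x) * cmod (e (v k))"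
      using n0 by (simp add: norm_mult)
    have "nrm Y (U k x) \<le> ?N (U k)"
      by (rule operator_norm_ball[OF Ub x(1)])
    also have "\<dots> \<le> ?M"
      using A T by (intro operator_norm_diff_le[OF Ub] close) auto
    finally have "nrm Y (U k x) * (1 - cmod (e (v k))) \<le> ?M * (1 - cmod (e (v k)))"
      using v1[OF eB, of k] by (intro mult_right_mono) auto
    then have "?N (U k) - \<kappa> < cmod (e (U k x))"
      using k x(3) by (simp add: eq algebra_simps)
    then show "\<exists>S\<in>A. \<exists>x\<in>?BX. ?N S - \<kappa> < cmod (e (S x)) \<and>
        (\<forall>z\<in>?BX. \<forall>f\<in>?BY. cmod (f (S z) - f (T z)) \<le> \<epsilon>)"
      using UA x(1) close by blast
  qed
qed

end

section \<open>Smooth functionals and the range strongly exposing property\<close>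

context normed_space
begin

lemma limitin_smult:
  assumes a: "\<And>n. a n \<in> carrier X" and lim: "limitin (norm_topology X) a y sequentially"
    and \<theta>: "\<And>n. \<theta> n \<in> K" "l \<in> K" "\<theta> \<longlonglongrightarrow> l"
  shows "limitin (norm_topology X) (\<lambda>n. \<theta> n \<odot> a n) (l \<odot> y) sequentially"
proof -
  have y: "y \<in> carrier X" and ay: "(\<lambda>n. nrm X (a n \<ominus>\<^bsub>X\<^esub> y)) \<longlonglongrightarrow> 0"
    using lim by (auto simp: limitin_norm_topology[OF a])
  have bound: "nrm X (\<theta> n \<odot> a n \<ominus>\<^bsub>X\<^esub> l \<odot> y) \<le>
      cmod (\<theta> n) * nrm X (a n \<ominus>\<^bsub>X\<^esub> y) + cmod (\<theta> n - l) * nrm X y" for n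
  proof -
    have "\<theta> n \<odot> a n \<ominus>\<^bsub>X\<^esub> l \<odot> y = \<theta> n \<odot> (a n \<ominus>\<^bsub>X\<^esub> y) \<oplus> (\<theta> n - l) \<odot> y"
      using smult_add_left[of "\<theta> n" "- l" y] smult_add_left[of "- \<theta> n" "\<theta> n - l" y]
      by (simp add: diff_eq_smult smult_add_right smult_smult a y \<theta> M.a_assoc)
    then show ?thesis
      using nrm_triangle[of "\<theta> n \<odot> (a n \<ominus>\<^bsub>X\<^esub> y)" "(\<theta> n - l) \<odot> y"]
      by (simp add: nrm_smult a y \<theta>)
  qed
  have "(\<lambda>n. cmod (\<theta> n) * nrm X (a n \<ominus>\<^bsub>X\<^esub> y) + cmod (\<theta> n - l) * nrm X y)
      \<longlonglongrightarrow> cmod l * 0 + cmod (l - l) * nrm X y"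
    by (intro tendsto_intros \<theta> ay)
  then have upper: "(\<lambda>n. cmod (\<theta> n) * nrm X (a n \<ominus>\<^bsub>X\<^esub> y) + cmod (\<theta> n - l) * nrm X y) \<longlonglongrightarrow> 0"
    by simp
  have nonneg: "0 \<le> nrm X (\<theta> n \<odot> a n \<ominus>\<^bsub>X\<^esub> l \<odot> y)" for n
    by (rule nrm_nonneg) (simp add: a y \<theta>)
  have "(\<lambda>n. nrm X (\<theta> n \<odot> a n \<ominus>\<^bsub>X\<^esub> l \<odot> y)) \<longlonglongrightarrow> 0"
    by (rule tendsto_sandwich[OF always_eventually always_eventually tendsto_const upper];
        intro allI nonneg bound)
  then show ?thesis
    using a y \<theta> by (simp add: limitin_norm_topology)
qed

lemma functional_limit:
  assumes a: "\<And>n. a n \<in> carrier X" and lim: "limitin (norm_topology X) a y sequentially"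
    and f: "f \<in> carrier (dual K X)"
  shows "(\<lambda>n. f (a n)) \<longlonglongrightarrow> f y"
proof -
  have y: "y \<in> carrier X" and ay: "(\<lambda>n. nrm X (a n \<ominus>\<^bsub>X\<^esub> y)) \<longlonglongrightarrow> 0"
    using lim by (auto simp: limitin_norm_topology[OF a])
  have "\<forall>n. cmod (f (a n) - f y) \<le> nrm (dual K X) f * nrm X (a n \<ominus>\<^bsub>X\<^esub> y)"
    using functional_bound[OF f] a y by (simp flip: functional_diff[OF f])
  moreover have "(\<lambda>n. nrm (dual K X) f * nrm X (a n \<ominus>\<^bsub>X\<^esub> y)) \<longlonglongrightarrow> 0"
    using tendsto_mult_right_zero[OF ay] .
  ultimately have "(\<lambda>n. f (a n) - f y) \<longlonglongrightarrow> 0"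
    by (rule Lim_null_comparison[OF always_eventually])
  then show ?thesis
    by (rule LIM_zero_cancel)
qed

lemma functionals_separate_points:
  assumes "x \<in> carrier X" "y \<in> carrier X" "\<And>f. f \<in> carrier (dual K X) \<Longrightarrow> f x = f y"
  shows "x = y"
proof -
  have "nrm X (x \<ominus>\<^bsub>X\<^esub> y) \<le> 0"
    using assms by (intro nrm_le_pairing) (auto simp: functional_diff unit_ball_carrier)
  then show ?thesis
    using assms nrm_nonneg[of "x \<ominus>\<^bsub>X\<^esub> y"] nrm_eq_0_iff[of "x \<ominus>\<^bsub>X\<^esub> y"] diff_eq_0_iff[of x y] by simp
qed

text \<open>
  For \<open>t > 0\<close> the inequality \<open>Re ((\<phi> + t h) (u n)) \<le> \<parallel>\<phi> + t h\<parallel>\<close> bounds \<open>Re (h (u n))\<close> from above by the difference quotient of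
  the norm at \<open>\<phi>\<close> in direction \<open>h\<close>, up to an error that vanishes with \<open>\<parallel>\<phi>\<parallel> - Re (\<phi> (u n))\<close>; for \<open>t < 0\<close> it bounds it
  from below. Differentiability squeezes \<open>Re (h (u n))\<close> to the derivative. The constant sequence \<open>x\<close> is of the
  same kind, which identifies the derivative as \<open>Re (h x)\<close>.
\<close>

theorem Smulyan:
  assumes \<phi>: "\<phi> \<in> smooth_points (dual K X)"
    and x: "x \<in> unit_ball X" "\<phi> x = of_real (nrm (dual K X) \<phi>)"
    and u: "\<And>n. u n \<in> unit_ball X" "(\<lambda>n. \<phi> (u n)) \<longlonglongrightarrow> of_real (nrm (dual K X) \<phi>)"
  shows "weakly_converges K X u x"
proof -
  interpret D: normed_space K "dual K X" by (rule normed_space_dual)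
  let ?N = "nrm (dual K X)"
  obtain D where \<phi>d: "\<phi> \<in> carrier (dual K X)"
    and D: "\<And>h. h \<in> carrier (dual K X) \<Longrightarrow>
      ((\<lambda>t::real. complex_of_real ((?N (\<phi> \<oplus>\<^bsub>dual K X\<^esub> of_real t \<odot>\<^bsub>dual K X\<^esub> h) - ?N \<phi>) / t)) \<longlongrightarrow> D h) (at 0)"
    using \<phi> unfolding smooth_points_def by blast
  have Re_lim: "(\<lambda>n. Re (h (z n))) \<longlonglongrightarrow> Re (D h)"
    if h: "h \<in> carrier (dual K X)" and z: "\<And>n. z n \<in> unit_ball X" "(\<lambda>n. \<phi> (z n)) \<longlonglongrightarrow> of_real (?N \<phi>)"
    for h z
  proof (rule tendstoI)
    fix \<epsilon> :: real assume "0 < \<epsilon>"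
    define q where "q t = (?N (\<phi> \<oplus>\<^bsub>dual K X\<^esub> of_real t \<odot>\<^bsub>dual K X\<^esub> h) - ?N \<phi>) / t" for t :: real
    have "(q \<longlongrightarrow> Re (D h)) (at 0)"
      using tendsto_Re[OF D[OF h]] by (simp add: q_def[abs_def])
    then obtain \<delta> where "0 < \<delta>" and \<delta>: "\<And>t. t \<noteq> 0 \<Longrightarrow> \<bar>t\<bar> < \<delta> \<Longrightarrow> \<bar>q t - Re (D h)\<bar> < \<epsilon> / 2"
      using \<open>0 < \<epsilon>\<close> LIM_D[of q "Re (D h)" 0 "\<epsilon> / 2"] by auto
    define t where "t = \<delta> / 2"
    have t: "0 < t" "\<bar>q t - Re (D h)\<bar> < \<epsilon> / 2" "\<bar>q (- t) - Re (D h)\<bar> < \<epsilon> / 2"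
      using \<open>0 < \<delta>\<close> \<delta>[of "\<delta> / 2"] \<delta>[of "- (\<delta> / 2)"] by (simp_all add: t_def)
    have le: "Re (\<phi> (z n)) + s * Re (h (z n)) \<le> ?N \<phi> + s * q s" if "s \<noteq> 0" for s n
    proof -
      let ?g = "\<phi> \<oplus>\<^bsub>dual K X\<^esub> of_real s \<odot>\<^bsub>dual K X\<^esub> h"
      note zc = unit_ball_carrier[OF z(1)]
      have g: "?g \<in> carrier (dual K X)"
        using \<phi>d h by simp
      have "Re (\<phi> (z n)) + s * Re (h (z n)) = Re (?g (z n))"
        using zc[of n] by (simp add: dual_def)
      also have "\<dots> \<le> cmod (?g (z n))"
        by (rule complex_Re_le_cmod)
      also have "\<dots> \<le> ?N ?g * nrm X (z n)"
        by (rule functional_bound[OF g zc])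
      also have "\<dots> \<le> ?N ?g * 1"
        using z(1)[of n] D.nrm_nonneg[OF g] by (intro mult_left_mono) (auto simp: unit_ball_def)
      finally show ?thesis
        using that by (simp add: q_def)
    qed
    have "(\<lambda>n. (?N \<phi> - Re (\<phi> (z n))) / t) \<longlonglongrightarrow> (?N \<phi> - Re (of_real (?N \<phi>))) / t"
      using t(1) by (intro tendsto_intros z(2)) auto
    then have "eventually (\<lambda>n. (?N \<phi> - Re (\<phi> (z n))) / t < \<epsilon> / 2) sequentially"
      using \<open>0 < \<epsilon>\<close> by (intro order_tendstoD(2)) auto
    then show "eventually (\<lambda>n. dist (Re (h (z n))) (Re (D h)) < \<epsilon>) sequentially"
    proof eventually_elim
      case (elim n)
      have "Re (h (z n)) \<le> q t + (?N \<phi> - Re (\<phi> (z n))) / t"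
        using le[of t n] t(1) by (simp add: field_simps)
      moreover have "q (- t) - (?N \<phi> - Re (\<phi> (z n))) / t \<le> Re (h (z n))"
        using le[of "- t" n] t(1) by (simp add: field_simps)
      ultimately show ?case
        using elim t unfolding dist_real_def by linarith
    qed
  qed
  have Re_conv: "(\<lambda>n. Re (h (u n))) \<longlonglongrightarrow> Re (h x)" if h: "h \<in> carrier (dual K X)" for h
  proof -
    have "(\<lambda>n. Re (h x)) \<longlonglongrightarrow> Re (D h)"
      using x by (intro Re_lim[OF h]) auto
    then have "Re (D h) = Re (h x)"
      by (rule LIMSEQ_unique) simp
    then show ?thesis
      using Re_lim[OF h u] by simp
  qed
  have uc: "u n \<in> carrier X" for n
    by (rule unit_ball_carrier[OF u(1)])
  have xc: "x \<in> carrier X"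
    by (rule unit_ball_carrier[OF x(1)])
  show ?thesis
    unfolding weakly_converges_def
  proof (intro conjI ballI)
    fix h assume h: "h \<in> carrier (dual K X)"
    have "(\<lambda>n. Im (h (u n))) \<longlonglongrightarrow> Im (h x)"
    proof (cases "K = UNIV")
      case True
      \<comment> \<open>The imaginary part of \<open>h\<close> is the real part of \<open>- \<i> h\<close>.\<close>
      have "- \<i> \<in> K" using True by (simp only: UNIV_I)
      then have "(- \<i>) \<odot>\<^bsub>dual K X\<^esub> h \<in> carrier (dual K X)"
        by (intro D.smult_closed h) simp
      from Re_conv[OF this] show ?thesis
        using uc xc by (simp add: dual_def)
    next
      case False
      then have "K = \<real>" using scalars by auto
      then show ?thesis
        using functional_closed[OF h uc] functional_closed[OF h xc] by (simp add: complex_is_Real_iff)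
    qed
    with Re_conv[OF h] show "(\<lambda>n. h (u n)) \<longlonglongrightarrow> h x"
      by (simp add: tendsto_complex_iff)
  qed (use uc xc in auto)
qed

end

context normed_space_pair
begin

lemma zero_in_RSE:
  assumes T: "T \<in> bounded_operators K X Y" and zero: "operator_norm X Y T = 0"
    and nonzero: "carrier X \<noteq> {\<zero>\<^bsub>X\<^esub>}"
  shows "T \<in> RSE K X Y"
proof -
  have T0: "T x = \<zero>\<^bsub>Y\<^esub>" if "x \<in> carrier X" for x
    using operator_norm_bound[OF T that] operator_closed[OF T that] cod.nrm_nonneg[of "T x"]
      cod.nrm_eq_0_iff[of "T x"] by (simp add: zero)
  obtain z where z: "z \<in> carrier X" "z \<noteq> \<zero>\<^bsub>X\<^esub>"
    using nonzero dom.M.zero_closed by blast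
  define x0 where "x0 = of_real (inverse (nrm X z)) \<odot>\<^bsub>X\<^esub> z"
  have x0: "x0 \<in> unit_sphere X"
    unfolding x0_def by (rule dom.normalize(1)[OF z])
  then have x0c: "x0 \<in> carrier X" by (simp add: unit_sphere_def)
  have "limitin (norm_topology Y) (\<lambda>n. T (x (id n))) (1 \<odot>\<^bsub>Y\<^esub> T x0) sequentially"
    if "range x \<subseteq> unit_ball X" for x :: "nat \<Rightarrow> 'a"
  proof -
    have "x n \<in> carrier X" for n
      using that by (auto intro: unit_ball_carrier)
    then show ?thesis
      using x0c cod.limitin_norm_topology[of "\<lambda>_. \<zero>\<^bsub>Y\<^esub>" "\<zero>\<^bsub>Y\<^esub>"]
        cod.diff_eq_0_iff[of "\<zero>\<^bsub>Y\<^esub>" "\<zero>\<^bsub>Y\<^esub>"]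
      by (simp add: T0 del: limitin_const_iff)
  qed
  moreover have "1 \<in> unit_scalars K"
    by (simp add: unit_scalars_def)
  ultimately show ?thesis
    unfolding RSE_def using T x0 strict_mono_id by blast
qed

text \<open>
  If \<open>\<parallel>T (x n)\<parallel> \<rightarrow> \<parallel>T\<parallel>\<close>, then eventually \<open>\<parallel>T (x n)\<parallel>\<close> exceeds \<open>L\<close>, so the bound reads \<open>\<parallel>T (x n)\<parallel> \<le> c |\<phi> (x n)|\<close> and
  \<open>|\<phi> (x n)| \<rightarrow> \<parallel>\<phi>\<parallel>\<close>. Rotating by the phases \<open>\<theta> n\<close> of \<open>\<phi> (x n)\<close> gives a sequence that converges weakly to the point \<open>x0\<close>
  where \<open>\<phi>\<close> attains its norm; along a subsequence the phases converge, so the rotation can be undone in the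
  limit.
\<close>

theorem RSE_criterion:
  assumes T: "T \<in> dunford_pettis_operators K X Y"
    and \<phi>: "\<phi> \<in> smooth_points (dual K X)" "\<phi> \<in> NA K X" "0 < nrm (dual K X) \<phi>"
    and c: "0 < c" and L: "L < c * nrm (dual K X) \<phi>"
    and norm_T: "operator_norm X Y T = c * nrm (dual K X) \<phi>"
    and bound: "\<And>x. x \<in> unit_ball X \<Longrightarrow> nrm Y (T x) \<le> max L (c * cmod (\<phi> x))"
  shows "T \<in> RSE K X Y"
proof -
  let ?N = "nrm (dual K X) \<phi>"
  have Tb: "T \<in> bounded_operators K X Y"
    using T by (simp add: dunford_pettis_operators_def)
  have \<phi>d: "\<phi> \<in> carrier (dual K X)"
    using \<phi>(1) by (simp add: smooth_points_def)
  have \<phi>_le: "cmod (\<phi> x) \<le> ?N" if "x \<in> unit_ball X" for x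
  proof -
    have "cmod (\<phi> x) \<le> ?N * nrm X x"
      by (rule dom.functional_bound[OF \<phi>d unit_ball_carrier[OF that]])
    also have "\<dots> \<le> ?N * 1"
      using \<phi>(3) that by (intro mult_left_mono) (auto simp: unit_ball_def)
    finally show ?thesis by simp
  qed
  obtain x1 where x1: "x1 \<in> unit_ball X" "cmod (\<phi> x1) = ?N"
    using \<phi>(2) by (auto simp: NA_def)
  note x1c = unit_ball_carrier[OF x1(1)]
  define x0 where "x0 = cnj (sgn (\<phi> x1)) \<odot>\<^bsub>X\<^esub> x1"
  have s: "cnj (sgn (\<phi> x1)) \<in> K"
    using dom.functional_closed[OF \<phi>d x1c] by simp
  have x0B: "x0 \<in> unit_ball X"
    unfolding x0_def by (rule dom.smult_unit_ball[OF s _ x1(1)]) (simp add: norm_sgn)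
  note x0c = unit_ball_carrier[OF x0B]
  have \<phi>x0: "\<phi> x0 = of_real ?N"
    unfolding x0_def using x1(2) by (simp add: dom.functional_smult[OF \<phi>d s x1c] cnj_sgn_mult)
  have "?N \<le> ?N * nrm X x0"
    using dom.functional_bound[OF \<phi>d x0c] \<phi>(3) by (simp add: \<phi>x0)
  then have x0S: "x0 \<in> unit_sphere X"
    using x0B \<phi>(3) by (simp add: unit_ball_def unit_sphere_def)
  have "\<exists>\<sigma>::nat \<Rightarrow> nat. strict_mono \<sigma> \<and> (\<exists>\<theta>\<in>unit_scalars K.
      limitin (norm_topology Y) (\<lambda>n. T (x (\<sigma> n))) (\<theta> \<odot>\<^bsub>Y\<^esub> T x0) sequentially)"
    if x: "range x \<subseteq> unit_ball X" and lim: "(\<lambda>n. nrm Y (T (x n))) \<longlonglongrightarrow> operator_norm X Y T"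
    for x :: "nat \<Rightarrow> 'a"
  proof -
    have xB: "x n \<in> unit_ball X" for n using x by auto
    note xc = unit_ball_carrier[OF xB]
    have lower: "eventually (\<lambda>n. nrm Y (T (x n)) / c \<le> cmod (\<phi> (x n))) sequentially"
    proof -
      have "eventually (\<lambda>n. L < nrm Y (T (x n))) sequentially"
        using lim L by (intro order_tendstoD(1)[OF lim]) (simp add: norm_T)
      then show ?thesis
      proof eventually_elim
        case (elim n)
        then have "nrm Y (T (x n)) \<le> c * cmod (\<phi> (x n))"
          using bound[OF xB[of n]] by linarith
        then show ?case
          using c by (simp add: field_simps)
      qed
    qed
    have lower_lim: "(\<lambda>n. nrm Y (T (x n)) / c) \<longlonglongrightarrow> ?N"
      using tendsto_divide[OF lim tendsto_const, of c] c by (simp add: norm_T)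
    have \<phi>_lim: "(\<lambda>n. cmod (\<phi> (x n))) \<longlonglongrightarrow> ?N"
      by (rule tendsto_sandwich[OF lower always_eventually lower_lim tendsto_const])
        (simp add: \<phi>_le xB)
    \<comment> \<open>The value 1 keeps \<open>\<theta> n\<close> unimodular at the indices where \<open>\<phi> (x n)\<close> vanishes.\<close>
    define \<theta> where "\<theta> n = (if \<phi> (x n) = 0 then 1 else sgn (\<phi> (x n)))" for n
    have \<theta>: "\<theta> n \<in> unit_scalars K" for n
      using dom.functional_closed[OF \<phi>d xc[of n]] by (simp add: \<theta>_def unit_scalars_def norm_sgn)
    have "unit_scalars K = K \<inter> sphere 0 1"
      by (auto simp: unit_scalars_def)
    then have "compact (unit_scalars K)"
      using closed_Int_compact[OF dom.closed_scalars compact_sphere] by simp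
    then obtain l r where l: "l \<in> unit_scalars K" and r: "strict_mono (r :: nat \<Rightarrow> nat)"
      and \<theta>_lim: "(\<theta> \<circ> r) \<longlonglongrightarrow> l"
      using \<theta> unfolding compact_def by meson
    have \<theta>K: "\<theta> n \<in> K" "cmod (\<theta> n) = 1" for n
      using \<theta>[of n] by (auto simp: unit_scalars_def)
    define u where "u n = cnj (\<theta> (r n)) \<odot>\<^bsub>X\<^esub> x (r n)" for n
    have uB: "u n \<in> unit_ball X" for n
      unfolding u_def by (rule dom.smult_unit_ball[OF _ _ xB]) (simp_all add: \<theta>K)
    note uc = unit_ball_carrier[OF uB]
    have "\<phi> (u n) = of_real (cmod (\<phi> (x (r n))))" for n
    proof -
      have "\<phi> (u n) = cnj (\<theta> (r n)) * \<phi> (x (r n))"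
        unfolding u_def by (rule dom.functional_smult[OF \<phi>d _ xc]) (simp add: \<theta>K)
      then show ?thesis
        by (simp add: \<theta>_def cnj_sgn_mult)
    qed
    moreover have "(\<lambda>n. of_real (cmod (\<phi> (x (r n))))) \<longlonglongrightarrow> (of_real ?N :: complex)"
      using LIMSEQ_subseq_LIMSEQ[OF \<phi>_lim r] by (intro tendsto_of_real) (simp add: o_def)
    ultimately have "(\<lambda>n. \<phi> (u n)) \<longlonglongrightarrow> of_real ?N"
      by simp
    then have weak: "weakly_converges K X u x0"
      by (rule dom.Smulyan[OF \<phi>(1) x0B \<phi>x0 uB])
    then obtain y where y: "limitin (norm_topology Y) (\<lambda>n. T (u n)) y sequentially"
      using T unfolding dunford_pettis_operators_def by blast
    note Tu = operator_closed[OF Tb uc] and Tx0 = operator_closed[OF Tb x0c]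
    have yc: "y \<in> carrier Y"
      using y by (simp add: cod.limitin_norm_topology[OF Tu])
    \<comment> \<open>The norm limit is also the weak limit of \<open>T (u n)\<close>, and \<open>T\<close> is weakly continuous.\<close>
    have "y = T x0"
    proof (rule cod.functionals_separate_points[OF yc Tx0])
      fix f assume f: "f \<in> carrier (dual K Y)"
      have "(\<lambda>n. f (T (u n))) \<longlonglongrightarrow> f (T x0)"
        using weak pullback_functional[OF Tb f] uc x0c unfolding weakly_converges_def by force
      with cod.functional_limit[OF Tu y f] show "f y = f (T x0)"
        by (rule LIMSEQ_unique)
    qed
    then have "limitin (norm_topology Y) (\<lambda>n. \<theta> (r n) \<odot>\<^bsub>Y\<^esub> T (u n)) (l \<odot>\<^bsub>Y\<^esub> T x0) sequentially"
      using \<theta>_lim l y by (intro cod.limitin_smult Tu) (auto simp: \<theta>K unit_scalars_def o_def)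
    moreover have "\<theta> (r n) \<odot>\<^bsub>Y\<^esub> T (u n) = T (x (r n))" for n
    proof -
      have "\<theta> (r n) * cnj (\<theta> (r n)) = 1"
        using \<theta>K(2)[of "r n"] by (simp add: complex_norm_square[symmetric])
      then show ?thesis
        using operator_closed[OF Tb xc] by (simp add: u_def operator_smult[OF Tb] \<theta>K xc cod.smult_smult)
    qed
    ultimately show ?thesis
      using l r by auto
  qed
  then show ?thesis
    unfolding RSE_def using Tb x0S by blast
qed

end

section \<open>Operators into spaces with property quasi-beta\<close>

text \<open>
  The form in which the property is used. For each extreme point \<open>e\<close> there is one bound \<open>r < 1\<close> such that \<open>|e y|\<close> is
  approximated by functionals \<open>a\<close> of the family on whose partner \<open>u\<close> all the others have modulus at most \<open>r\<close>:
  the inequality \<open>s < |f y|\<close> defines a weak-star open set of functionals \<open>f\<close> containing a rotation of \<open>e\<close>.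
\<close>

lemma (in normed_space) quasi_beta_pairs:
  assumes "property_quasi_beta K X"
  obtains P where
    "\<And>a u. (a, u) \<in> P \<Longrightarrow> a \<in> unit_ball (dual K X) \<and> u \<in> unit_sphere X \<and> a u = 1"
    "\<And>e. e \<in> extreme_points (dual K X) (unit_ball (dual K X)) \<Longrightarrow>
      \<exists>r::real. 0 \<le> r \<and> r < 1 \<and> (\<forall>y\<in>carrier X. \<forall>s<cmod (e y).
        \<exists>(a, u)\<in>P. s < cmod (a y) \<and> (\<forall>(b, w)\<in>P. b \<noteq> a \<longrightarrow> cmod (b u) \<le> r))"
proof -
  obtain \<Lambda> :: "(('a \<Rightarrow> complex) \<times> 'a) set" and ystar y A and \<rho> :: "('a \<Rightarrow> complex) \<Rightarrow> real"
    where qb: "A = ystar ` \<Lambda> \<and> A \<subseteq> unit_sphere (dual K X) \<and> y ` \<Lambda> \<subseteq> unit_sphere X \<and>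
      (\<forall>\<alpha>\<in>\<Lambda>. ystar \<alpha> (y \<alpha>) = 1) \<and>
      (\<forall>\<alpha>\<in>\<Lambda>. \<forall>z\<in>A. z \<noteq> ystar \<alpha> \<longrightarrow>
        cmod (z (y \<alpha>)) \<le> \<rho> (ystar \<alpha>) \<and> \<rho> (ystar \<alpha>) < 1) \<and>
      (\<forall>e\<in>extreme_points (dual K X) (unit_ball (dual K X)).
        \<exists>A\<^sub>e t. A\<^sub>e \<subseteq> A \<and> t \<in> unit_scalars K \<and>
          t \<odot>\<^bsub>dual K X\<^esub> e \<in> weak_star_topology K X closure_of A\<^sub>e \<and>
          (SUP a\<in>A\<^sub>e. \<rho> a) < 1)"
    using assms unfolding property_quasi_beta_def by (elim exE)
  then have A: "A = ystar ` \<Lambda>" and AS: "A \<subseteq> unit_sphere (dual K X)"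
    and yS: "y ` \<Lambda> \<subseteq> unit_sphere X" and one: "\<And>\<alpha>. \<alpha> \<in> \<Lambda> \<Longrightarrow> ystar \<alpha> (y \<alpha>) = 1"
    and sep: "\<And>\<alpha> z. \<alpha> \<in> \<Lambda> \<Longrightarrow> z \<in> A \<Longrightarrow> z \<noteq> ystar \<alpha> \<Longrightarrow>
      cmod (z (y \<alpha>)) \<le> \<rho> (ystar \<alpha>) \<and> \<rho> (ystar \<alpha>) < 1"
    and ext: "\<And>e. e \<in> extreme_points (dual K X) (unit_ball (dual K X)) \<Longrightarrow>
        \<exists>A\<^sub>e t. A\<^sub>e \<subseteq> A \<and> t \<in> unit_scalars K \<and>
          t \<odot>\<^bsub>dual K X\<^esub> e \<in> weak_star_topology K X closure_of A\<^sub>e \<and>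
          (SUP a\<in>A\<^sub>e. \<rho> a) < 1"
    by blast+
  define P where "P = (\<lambda>\<alpha>. (ystar \<alpha>, y \<alpha>)) ` \<Lambda>"
  show thesis
  proof (rule that[of P])
    fix a u assume "(a, u) \<in> P"
    then obtain \<alpha> where \<alpha>: "\<alpha> \<in> \<Lambda>" "a = ystar \<alpha>" "u = y \<alpha>"
      by (auto simp: P_def)
    have "a \<in> unit_sphere (dual K X)" "u \<in> unit_sphere X"
      using \<alpha> A AS yS by auto
    then show "a \<in> unit_ball (dual K X) \<and> u \<in> unit_sphere X \<and> a u = 1"
      using one[OF \<alpha>(1)] \<alpha>(2,3) by (simp add: unit_sphere_ball)
  next
    fix e assume e: "e \<in> extreme_points (dual K X) (unit_ball (dual K X))"
    obtain A\<^sub>e t where Ae: "A\<^sub>e \<subseteq> A" and t: "t \<in> unit_scalars K"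
      and cl: "t \<odot>\<^bsub>dual K X\<^esub> e \<in> weak_star_topology K X closure_of A\<^sub>e"
      and Sup: "(SUP a\<in>A\<^sub>e. \<rho> a) < 1"
      using ext[OF e] by blast
    define r where "r = max 0 (SUP a\<in>A\<^sub>e. \<rho> a)"
    show "\<exists>r::real. 0 \<le> r \<and> r < 1 \<and> (\<forall>y\<in>carrier X. \<forall>s<cmod (e y).
        \<exists>(a, u)\<in>P. s < cmod (a y) \<and> (\<forall>(b, w)\<in>P. b \<noteq> a \<longrightarrow> cmod (b u) \<le> r))"
    proof (intro exI[of _ r] conjI ballI allI impI)
      show "0 \<le> r" "r < 1"
        using Sup by (auto simp: r_def)
      fix z s assume z: "z \<in> carrier X" and s: "s < cmod (e z)"
      have tez: "cmod ((t \<odot>\<^bsub>dual K X\<^esub> e) z) = cmod (e z)"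
        using z t by (simp add: dual_def norm_mult unit_scalars_def)
      let ?W = "weak_star_topology K X"
      define V where "V = {f \<in> topspace ?W. cmod (f z) \<in> {s<..}}"
      have W: "?W = subtopology (pointwise_topology X) (carrier (dual K X))"
        by (simp add: weak_star_topology_def pointwise_topology_def)
      have "continuous_map ?W euclidean (\<lambda>f. cmod (f z))"
        unfolding W by (intro continuous_map_from_subtopology continuous_map_evaluation[OF z] continuous_intros)
      then have "openin ?W V"
        unfolding V_def by (rule openin_continuous_map_preimage) simp
      moreover have "t \<odot>\<^bsub>dual K X\<^esub> e \<in> V"
        using cl s tez by (auto simp: V_def in_closure_of)
      ultimately obtain a where aV: "a \<in> A\<^sub>e" "a \<in> V"
        using cl[unfolded in_closure_of, THEN conjunct2, rule_format, of V] by metis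
      then have a: "a \<in> A\<^sub>e" "s < cmod (a z)"
        by (simp_all add: V_def)
      obtain \<alpha> where \<alpha>: "\<alpha> \<in> \<Lambda>" "a = ystar \<alpha>"
        using a(1) Ae A by blast
      have "cmod (b (y \<alpha>)) \<le> r" if bw: "(b, w) \<in> P" "b \<noteq> a" for b w
      proof -
        have bA: "b \<in> A" and aA: "a \<in> A"
          using bw(1) a(1) Ae by (auto simp: P_def A)
        \<comment> \<open>The supremum of \<open>\<rho>\<close> is meaningful only if \<open>\<rho>\<close> is bounded on the set. Once the family contains the
          two functionals \<open>a\<close> and \<open>b\<close>, every member has a competitor, and \<open>\<rho>\<close> is below 1 everywhere.\<close>
        have "\<rho> a' < 1" if a': "a' \<in> A\<^sub>e" for a'
        proof -
          obtain \<beta> where \<beta>: "\<beta> \<in> \<Lambda>" "a' = ystar \<beta>"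
            using a' Ae A by blast
          show ?thesis
            using sep[OF \<beta>(1) aA] sep[OF \<beta>(1) bA] \<beta>(2) bw(2) by metis
        qed
        then have "bdd_above (\<rho> ` A\<^sub>e)"
          by (intro bdd_aboveI2[of _ _ 1]) (simp add: less_imp_le)
        then have "\<rho> a \<le> (SUP a\<in>A\<^sub>e. \<rho> a)"
          by (rule cSUP_upper[OF a(1)])
        then show ?thesis
          using sep[OF \<alpha>(1) bA] bw(2) \<alpha>(2) unfolding r_def by (intro max.coboundedI2) simp
      qed
      then show "\<exists>(a, u)\<in>P. s < cmod (a z) \<and> (\<forall>(b, w)\<in>P. b \<noteq> a \<longrightarrow> cmod (b u) \<le> r)"
        using a \<alpha> by (intro bexI[of _ "(a, y \<alpha>)"]) (auto simp: P_def)
    qed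
  qed
qed

context normed_space_pair
begin

text \<open>
  Here \<open>e\<close>, and with it \<open>r\<close>, is fixed first. Then \<open>S\<close> near \<open>T\<close> and \<open>a\<close> are chosen such that \<open>\<parallel>a \<circ> S\<parallel>\<close> is within \<open>\<kappa>\<close> of \<open>\<parallel>S\<parallel>\<close>, where \<open>\<kappa>\<close> is
  small compared with \<open>\<eta> (1 - r)\<close>. With \<open>\<phi>\<close> within \<open>\<kappa>\<close> of \<open>a \<circ> S\<close>, the perturbation \<open>\<psi> = (1 + \<eta>) \<phi> - a \<circ> S\<close> has norm about
  \<open>\<eta> \<parallel>S\<parallel>\<close>. For \<open>R = S + \<psi> \<otimes> u\<close> one gets \<open>a \<circ> R = (1 + \<eta>) \<phi>\<close> of norm about \<open>(1 + \<eta>) \<parallel>S\<parallel>\<close>, whereas the other functionals of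
  the family reach only about \<open>(1 + r \<eta>) \<parallel>S\<parallel>\<close>.
\<close>

theorem RSE_perturbation:
  assumes A: "A \<subseteq> dunford_pettis_operators K X Y"
    and closed: "\<And>S g v. S \<in> A \<Longrightarrow> g \<in> carrier (dual K X) \<Longrightarrow> v \<in> carrier Y \<Longrightarrow>
      rank_one_update X Y S g v \<in> A"
    and nonzero: "carrier X \<noteq> {\<zero>\<^bsub>X\<^esub>}" "carrier Y \<noteq> {\<zero>\<^bsub>Y\<^esub>}"
    and dense: "norm_topology (dual K X) closure_of (smooth_points (dual K X) \<inter> NA K X)
      = carrier (dual K X)"
    and qb: "property_quasi_beta K Y"
    and T: "T \<in> A" "0 < operator_norm X Y T" and "0 < \<epsilon>"
  shows "\<exists>S\<in>A \<inter> RSE K X Y. \<forall>x\<in>unit_ball X. \<forall>f\<in>unit_ball (dual K Y). cmod (f (S x) - f (T x)) \<le> \<epsilon>"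
proof -
  let ?BX = "unit_ball X" and ?BY = "unit_ball (dual K Y)"
  interpret DX: normed_space K "dual K X" by (rule dom.normed_space_dual)
  have Ab: "A \<subseteq> bounded_operators K X Y"
    using A by (auto simp: dunford_pettis_operators_def)
  obtain P where P: "\<And>a u. (a, u) \<in> P \<Longrightarrow> a \<in> ?BY \<and> u \<in> unit_sphere Y \<and> a u = 1"
    and ext: "\<And>e. e \<in> extreme_points (dual K Y) ?BY \<Longrightarrow>
      \<exists>r::real. 0 \<le> r \<and> r < 1 \<and> (\<forall>y\<in>carrier Y. \<forall>s<cmod (e y).
        \<exists>(a, u)\<in>P. s < cmod (a y) \<and> (\<forall>(b, w)\<in>P. b \<noteq> a \<longrightarrow> cmod (b u) \<le> r))"
    using cod.quasi_beta_pairs[OF qb] by blast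
  have norming: "\<exists>(b, w)\<in>P. s < cmod (b y)" if y: "y \<in> carrier Y" and s: "s < nrm Y y" for y s
  proof -
    obtain e where e: "e \<in> extreme_points (dual K Y) ?BY" "cmod (e y) = nrm Y y"
      using cod.exists_norming_extreme_point[OF y] by blast
    have "s < cmod (e y)" using e(2) s by simp
    then show ?thesis
      using ext[OF e(1)] y by blast
  qed
  define N0 where "N0 = operator_norm X Y T"
  \<comment> \<open>The budget: \<open>S\<close> stays within \<open>\<epsilon> / 4\<close> of \<open>T\<close>, and its norm within \<open>N0 / 4\<close> of \<open>N0\<close>.\<close>
  define \<tau> where "\<tau> = min \<epsilon> N0 / 4"
  have "0 < N0" using T by (simp add: N0_def)
  have \<tau>: "0 < \<tau>" "\<tau> \<le> \<epsilon> / 4" "\<tau> \<le> N0 / 4"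
    using \<open>0 < N0\<close> \<open>0 < \<epsilon>\<close> by (auto simp: \<tau>_def)
  obtain e where e: "e \<in> extreme_points (dual K Y) ?BY"
    and near: "\<forall>\<kappa>>0. \<exists>S\<in>A. \<exists>x\<in>?BX. operator_norm X Y S - \<kappa> < cmod (e (S x)) \<and>
      (\<forall>z\<in>?BX. \<forall>f\<in>?BY. cmod (f (S z) - f (T z)) \<le> \<tau>)"
    by (rule adjoint_nearly_norming_extreme_point[OF Ab closed T(1) \<tau>(1) nonzero])
  obtain r :: real where r: "0 \<le> r" "r < 1"
    and pairs: "\<And>y s. y \<in> carrier Y \<Longrightarrow> s < cmod (e y) \<Longrightarrow>
        \<exists>(a, u)\<in>P. s < cmod (a y) \<and> (\<forall>(b, w)\<in>P. b \<noteq> a \<longrightarrow> cmod (b u) \<le> r)"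
    using ext[OF e] by blast
  \<comment> \<open>With \<open>N + \<kappa> \<le> 2 * N0\<close> this makes the part \<open>\<eta> * (N + \<kappa>)\<close> of the perturbation at most \<open>\<epsilon> / 4\<close>.\<close>
  define \<eta> where "\<eta> = \<epsilon> / (8 * N0)"
  have \<eta>: "0 < \<eta>" "\<eta> * N0 = \<epsilon> / 8"
    using \<open>0 < N0\<close> \<open>0 < \<epsilon>\<close> by (auto simp: \<eta>_def)
  \<comment> \<open>The last bound keeps three errors of size \<open>(1 + \<eta>) * \<kappa>\<close>, two from the norm of \<open>\<phi>\<close> and one from
    that of \<open>\<psi>\<close>, below the gain \<open>\<eta> * N * (1 - r)\<close> of \<open>a\<close> over its competitors, where \<open>N \<ge> 3 / 4 * N0\<close>.\<close>
  define \<kappa> where "\<kappa> = min (min (N0 / 4) (\<epsilon> / 4)) (\<eta> * N0 * (1 - r) / (8 * (1 + \<eta>)))"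
  have "0 < \<kappa>"
    using \<open>0 < N0\<close> \<open>0 < \<epsilon>\<close> \<eta>(1) r(2) by (simp add: \<kappa>_def)
  moreover have "\<kappa> \<le> N0 / 4" "\<kappa> \<le> \<epsilon> / 4" "\<kappa> \<le> \<eta> * N0 * (1 - r) / (8 * (1 + \<eta>))"
    unfolding \<kappa>_def by linarith+
  ultimately have \<kappa>: "0 < \<kappa>" "\<kappa> \<le> N0 / 4" "\<kappa> \<le> \<epsilon> / 4"
    "\<kappa> \<le> \<eta> * N0 * (1 - r) / (8 * (1 + \<eta>))" by auto
  then have \<kappa>4: "8 * ((1 + \<eta>) * \<kappa>) \<le> \<eta> * N0 * (1 - r)"
    using \<eta>(1) by (simp add: field_simps)
  obtain S x where SA: "S \<in> A" and x: "x \<in> ?BX"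
    and Sx: "operator_norm X Y S - \<kappa> < cmod (e (S x))"
    and ST: "\<And>z f. z \<in> ?BX \<Longrightarrow> f \<in> ?BY \<Longrightarrow> cmod (f (S z) - f (T z)) \<le> \<tau>"
    using near[rule_format, OF \<kappa>(1)] by blast
  have Sb: "S \<in> bounded_operators K X Y" and Tb: "T \<in> bounded_operators K X Y"
    using SA T Ab by auto
  define N where "N = operator_norm X Y S"
  have N: "3 / 4 * N0 \<le> N" "N \<le> 5 / 4 * N0"
    using operator_norm_diff_le[OF Sb Tb ST] operator_norm_diff_le[OF Tb Sb, of \<tau>] ST \<tau>
    by (auto simp: N_def N0_def norm_minus_commute)
  note xc = unit_ball_carrier[OF x]
  obtain a u where au: "(a, u) \<in> P" and aSx: "N - \<kappa> < cmod (a (S x))"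
    and others: "\<And>b w. (b, w) \<in> P \<Longrightarrow> b \<noteq> a \<Longrightarrow> cmod (b u) \<le> r"
    using pairs[OF operator_closed[OF Sb xc] Sx] unfolding N_def by blast
  have a: "a \<in> ?BY" and u: "u \<in> unit_sphere Y" and au1: "a u = 1"
    using P[OF au] by auto
  note ad = unit_ball_carrier[OF a]
  have uc: "u \<in> carrier Y" and u1: "nrm Y u = 1" using u by (auto simp: unit_sphere_def)
  define g where "g = (\<lambda>z\<in>carrier X. a (S z))"
  have g: "g \<in> carrier (dual K X)"
    unfolding g_def by (rule pullback_functional[OF Sb ad])
  have "g \<in> norm_topology (dual K X) closure_of (smooth_points (dual K X) \<inter> NA K X)"
    using g dense by simp
  moreover have "smooth_points (dual K X) \<inter> NA K X \<subseteq> carrier (dual K X)"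
    by (auto simp: smooth_points_def)
  ultimately obtain \<phi> where \<phi>: "\<phi> \<in> smooth_points (dual K X)" "\<phi> \<in> NA K X"
    and \<phi>g: "nrm (dual K X) (\<phi> \<ominus>\<^bsub>dual K X\<^esub> g) < \<kappa>"
    using DX.norm_closure_iff \<kappa>(1) by blast
  have \<phi>d: "\<phi> \<in> carrier (dual K X)"
    using \<phi>(1) by (simp add: smooth_points_def)
  have functional_le: "cmod (h z) \<le> nrm (dual K X) h" if "h \<in> carrier (dual K X)" "z \<in> ?BX" for h z
  proof -
    have "cmod (h z) \<le> nrm (dual K X) h * nrm X z"
      by (rule dom.functional_bound[OF that(1) unit_ball_carrier[OF that(2)]])
    also have "\<dots> \<le> nrm (dual K X) h * 1"
      using DX.nrm_nonneg[OF that(1)] that(2) by (intro mult_left_mono) (auto simp: unit_ball_def)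
    finally show ?thesis by simp
  qed
  have diff: "cmod (\<phi> z - a (S z)) \<le> \<kappa>" if "z \<in> ?BX" for z
  proof -
    have "(\<phi> \<ominus>\<^bsub>dual K X\<^esub> g) z = \<phi> z - a (S z)"
      using unit_ball_carrier[OF that] DX.diff_eq_smult[OF \<phi>d g] by (simp add: dual_def g_def)
    then show ?thesis
      using functional_le[OF DX.M.minus_closed[OF \<phi>d g] that] \<phi>g by simp
  qed
  let ?n = "nrm (dual K X) \<phi>"
  obtain x1 where x1: "x1 \<in> ?BX" "cmod (\<phi> x1) = ?n"
    using \<phi>(2) by (auto simp: NA_def)
  have aS: "cmod (a (S z)) \<le> N" if "z \<in> ?BX" for z
    unfolding N_def by (rule pairing_le_operator_norm[OF Sb that a])
  have \<phi>_le: "cmod (\<phi> z) \<le> N + \<kappa>" if "z \<in> ?BX" for z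
    using norm_triangle_sub[of "\<phi> z" "a (S z)"] diff[OF that] aS[OF that] by simp
  have n_lower: "N - 2 * \<kappa> < ?n"
    using norm_triangle_sub[of "a (S x)" "\<phi> x"] diff[OF x] aSx functional_le[OF \<phi>d x]
    by (simp add: norm_minus_commute)
  define \<psi> where "\<psi> = of_real (1 + \<eta>) \<odot>\<^bsub>dual K X\<^esub> \<phi> \<ominus>\<^bsub>dual K X\<^esub> g"
  have \<psi>: "\<psi> \<in> carrier (dual K X)"
    unfolding \<psi>_def by (intro DX.M.minus_closed DX.smult_closed \<phi>d g) (simp only: scalar_ring_simps dom.scalar_closed)
  have \<psi>_eq: "\<psi> z = of_real (1 + \<eta>) * \<phi> z - a (S z)" if "z \<in> ?BX" for z
  proof -
    have "of_real (1 + \<eta>) \<odot>\<^bsub>dual K X\<^esub> \<phi> \<in> carrier (dual K X)"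
      by (intro DX.smult_closed \<phi>d) (simp only: scalar_ring_simps dom.scalar_closed)
    from DX.diff_eq_smult[OF this g] show ?thesis
      unfolding \<psi>_def using unit_ball_carrier[OF that] by (simp add: dual_def g_def)
  qed
  define M where "M = \<eta> * (N + \<kappa>) + \<kappa>"
  have \<psi>_le: "cmod (\<psi> z) \<le> M" if "z \<in> ?BX" for z
  proof -
    have "\<psi> z = of_real \<eta> * \<phi> z + (\<phi> z - a (S z))"
      by (simp add: \<psi>_eq[OF that] algebra_simps)
    then have "cmod (\<psi> z) \<le> \<eta> * cmod (\<phi> z) + cmod (\<phi> z - a (S z))"
      using norm_triangle_ineq[of "of_real \<eta> * \<phi> z" "\<phi> z - a (S z)"] \<eta>(1) by (simp add: norm_mult)
    also have "\<dots> \<le> M"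
      unfolding M_def using \<eta>(1) \<phi>_le[OF that] diff[OF that] by (intro add_mono mult_left_mono) auto
    finally show ?thesis .
  qed
  define R where "R = rank_one_update X Y S \<psi> u"
  have RA: "R \<in> A"
    unfolding R_def by (rule closed[OF SA \<psi> uc])
  then have Rb: "R \<in> bounded_operators K X Y" using Ab by auto
  have R_eq: "f (R z) = f (S z) + \<psi> z * f u" if "z \<in> ?BX" "f \<in> ?BY" for z f
    unfolding R_def
    by (rule functional_rank_one_update[OF Sb \<psi> uc unit_ball_carrier[OF that(2)] unit_ball_carrier[OF that(1)]])
  have aR: "cmod (a (R z)) = (1 + \<eta>) * cmod (\<phi> z)" if "z \<in> ?BX" for z
  proof -
    have "a (R z) = of_real (1 + \<eta>) * \<phi> z"
      by (simp add: R_eq[OF that a] \<psi>_eq[OF that] au1)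
    then show ?thesis
      using \<eta>(1) by (simp only: norm_mult norm_of_real)
  qed
  define L where "L = N + r * M"
  have bound: "nrm Y (R z) \<le> max L ((1 + \<eta>) * cmod (\<phi> z))" if z: "z \<in> ?BX" for z
  proof (rule ccontr)
    assume "\<not> ?thesis"
    then have "max L ((1 + \<eta>) * cmod (\<phi> z)) < nrm Y (R z)" by (simp only: not_le)
    from norming[OF operator_closed[OF Rb unit_ball_carrier[OF z]] this]
    obtain b w where bw: "(b, w) \<in> P" and less: "max L ((1 + \<eta>) * cmod (\<phi> z)) < cmod (b (R z))"
      by blast
    have b: "b \<in> ?BY" using P[OF bw] by auto
    have "b \<noteq> a"
      using less aR[OF z] by auto
    then have "cmod (b u) \<le> r" using others bw by blast
    then have "cmod (\<psi> z) * cmod (b u) \<le> M * r"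
      using \<psi>_le[OF z] r(1) by (intro mult_mono) (auto intro: order_trans[OF norm_ge_zero])
    then have "cmod (b (R z)) \<le> L"
      using norm_triangle_ineq[of "b (S z)" "\<psi> z * b u"] pairing_le_operator_norm[OF Sb z b]
      by (simp add: R_eq[OF z b] norm_mult L_def N_def mult.commute)
    then show False using less by simp
  qed
  have L: "L < (1 + \<eta>) * ?n"
  proof -
    have "L + 3 * ((1 + \<eta>) * \<kappa>) \<le> N + r * \<eta> * N + r * ((1 + \<eta>) * \<kappa>) + 3 * ((1 + \<eta>) * \<kappa>)"
      by (simp add: L_def M_def algebra_simps)
    also have "\<dots> \<le> N + r * \<eta> * N + 4 * ((1 + \<eta>) * \<kappa>)"
      using mult_right_mono[of r 1 "(1 + \<eta>) * \<kappa>"] r \<eta>(1) \<kappa>(1) by simp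
    also have "\<dots> \<le> N + r * \<eta> * N + \<eta> * N0 * (1 - r) / 2"
      using \<kappa>4 by simp
    also have "\<eta> * N0 * (1 - r) / 2 \<le> \<eta> * N * (1 - r)"
    proof -
      have "\<eta> * (N0 / 2) * (1 - r) \<le> \<eta> * N * (1 - r)"
        using N \<open>0 < N0\<close> \<eta>(1) r by (intro mult_right_mono mult_left_mono) auto
      then show ?thesis by simp
    qed
    finally have "L + 3 * ((1 + \<eta>) * \<kappa>) \<le> (1 + \<eta>) * N"
      by (simp add: algebra_simps)
    moreover have "0 < (1 + \<eta>) * \<kappa>" using \<eta>(1) \<kappa>(1) by simp
    moreover have "(1 + \<eta>) * (N - 2 * \<kappa>) < (1 + \<eta>) * ?n"
      using n_lower \<eta>(1) by (intro mult_strict_left_mono) auto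
    moreover have "(1 + \<eta>) * (N - 2 * \<kappa>) = (1 + \<eta>) * N - 2 * ((1 + \<eta>) * \<kappa>)"
      by (simp add: algebra_simps)
    ultimately show ?thesis by linarith
  qed
  have "R \<in> RSE K X Y"
  proof (rule RSE_criterion[OF _ \<phi> _ _ L _ bound])
    show "R \<in> dunford_pettis_operators K X Y" using RA A by auto
    show "0 < ?n" using n_lower N \<kappa>(2) \<open>0 < N0\<close> by simp
    show "0 < 1 + \<eta>" using \<eta>(1) by simp
    show "operator_norm X Y R = (1 + \<eta>) * ?n"
    proof (rule antisym)
      show "operator_norm X Y R \<le> (1 + \<eta>) * ?n"
      proof (rule operator_norm_le)
        fix z assume z: "z \<in> ?BX"
        have "(1 + \<eta>) * cmod (\<phi> z) \<le> (1 + \<eta>) * ?n"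
          using functional_le[OF \<phi>d z] \<eta>(1) by (intro mult_left_mono) auto
        then show "nrm Y (R z) \<le> (1 + \<eta>) * ?n"
          using bound[OF z] L by simp
      qed
      show "(1 + \<eta>) * ?n \<le> operator_norm X Y R"
        using pairing_le_operator_norm[OF Rb x1(1) a] aR[OF x1(1)] x1(2) by simp
    qed
  qed
  moreover have "cmod (f (R z) - f (T z)) \<le> \<epsilon>" if z: "z \<in> ?BX" and f: "f \<in> ?BY" for z f
  proof -
    have "cmod (f u) \<le> 1"
      using f uc u1 by (force simp: cod.dual_unit_ball_iff)
    then have "cmod (\<psi> z * f u) \<le> M * 1"
      unfolding norm_mult using \<psi>_le[OF z]
      by (intro mult_mono) (auto intro: order_trans[OF norm_ge_zero])
    moreover have "M \<le> \<epsilon> / 2"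
    proof -
      have "\<eta> * (N + \<kappa>) \<le> \<eta> * (2 * N0)"
        using N \<kappa>(2) \<open>0 < N0\<close> \<eta>(1) by (intro mult_left_mono) auto
      also have "\<dots> = \<epsilon> / 4" using \<eta>(2) by simp
      finally show ?thesis using \<kappa>(3) by (simp add: M_def)
    qed
    moreover have "cmod (f (R z) - f (T z)) \<le> cmod (f (S z) - f (T z)) + cmod (\<psi> z * f u)"
      using norm_triangle_ineq[of "f (S z) - f (T z)" "\<psi> z * f u"] by (simp add: R_eq[OF z f] algebra_simps)
    ultimately show ?thesis
      using ST[OF z f] \<tau>(2) \<open>0 < \<epsilon>\<close> by linarith
  qed
  ultimately show ?thesis using RA by blast
qed

end

theorem corollary4p5:
  fixes K :: "complex set"
    and X Y :: "'u nmodule"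
    and I :: "'u nmodule \<Rightarrow> 'u nmodule \<Rightarrow> ('u \<Rightarrow> 'u) set"
  assumes "banach_space K X" and "banach_space K Y"
    and "operator_ideal K I"
    and "norm_topology (dual K X) closure_of (smooth_points (dual K X) \<inter> NA K X)
      = carrier (dual K X)"
    and "property_quasi_beta K Y"
    and "I X Y \<subseteq> dunford_pettis_operators K X Y"
  shows "I X Y \<subseteq> norm_topology (operator_space K X Y) closure_of (I X Y \<inter> RSE K X Y)"
proof
  fix T assume T: "T \<in> I X Y"
  interpret X: banach_space K X by fact
  interpret Y: banach_space K Y by fact
  interpret normed_space_pair K X Y ..
  interpret L: normed_space K "operator_space K X Y"
    by (rule normed_space_operator_space)
  have ideal: "I X Y \<subseteq> bounded_operators K X Y" "finite_rank_operators K X Y \<subseteq> I X Y"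
    "\<And>S T. S \<in> I X Y \<Longrightarrow> T \<in> I X Y \<Longrightarrow> S \<oplus>\<^bsub>operator_space K X Y\<^esub> T \<in> I X Y"
    using assms(3)[unfolded operator_ideal_def, THEN conjunct1, rule_format, OF assms(1,2)] by auto
  have update: "rank_one_update X Y S g v \<in> I X Y"
    if "S \<in> I X Y" "g \<in> carrier (dual K X)" "v \<in> carrier Y" for S g v
    unfolding rank_one_update_eq
    using ideal(2) rank_one_finite_rank[OF that(2,3)] that(1) by (intro ideal(3)) auto
  have Tb: "T \<in> bounded_operators K X Y" using T ideal(1) by auto
  have sub: "I X Y \<inter> RSE K X Y \<subseteq> carrier (operator_space K X Y)"
    using ideal(1) by auto
  show "T \<in> norm_topology (operator_space K X Y) closure_of (I X Y \<inter> RSE K X Y)"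
    unfolding L.norm_closure_iff[OF sub]
  proof (intro conjI allI impI)
    show "T \<in> carrier (operator_space K X Y)" using Tb by simp
    fix \<epsilon> :: real assume "0 < \<epsilon>"
    show "\<exists>S\<in>I X Y \<inter> RSE K X Y. nrm (operator_space K X Y) (S \<ominus>\<^bsub>operator_space K X Y\<^esub> T) < \<epsilon>"
    proof (cases "operator_norm X Y T = 0")
      case True
      have "nrm (operator_space K X Y) (T \<ominus>\<^bsub>operator_space K X Y\<^esub> T) \<le> 0"
        by (rule nrm_operator_space_diff_le[OF Tb Tb]) simp
      then show ?thesis
        using zero_in_RSE[OF Tb True X.nonzero] T \<open>0 < \<epsilon>\<close> by (intro bexI[of _ T]) auto
    next
      case False
      then have "0 < operator_norm X Y T"
        using operator_norm_nonneg[OF Tb] by simp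
      from RSE_perturbation[OF assms(6) update X.nonzero Y.nonzero assms(4,5) T this, of "\<epsilon> / 2"]
      obtain S where S: "S \<in> I X Y \<inter> RSE K X Y" and
        close: "\<And>x f. x \<in> unit_ball X \<Longrightarrow> f \<in> unit_ball (dual K Y) \<Longrightarrow> cmod (f (S x) - f (T x)) \<le> \<epsilon> / 2"
        using \<open>0 < \<epsilon>\<close> by auto
      have "nrm (operator_space K X Y) (S \<ominus>\<^bsub>operator_space K X Y\<^esub> T) \<le> \<epsilon> / 2"
        by (rule nrm_operator_space_diff_le[OF _ Tb]) (use S ideal(1) close in auto)
      then show ?thesis
        using S \<open>0 < \<epsilon>\<close> by (intro bexI[of _ S]) auto
    qed
  qed
qed

end
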